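(* Suppose that: (Assumption 1) for each $i\in\mathcal N$, $J_i(x_i;x_{-i})$ is a proper, lower semicontinuous, convex function of $x_i$ for any fixed $x_{-i}$; (Assumption 2) each $\Omega_i$ is nonempty, closed and convex, and $\mathcal X$ is nonempty and satisfies Slater's constraint qualification; (Assumption 3) the communication graph $\mathcal G$ is directed, weakly connected and has no self-loops; (Assumption 5) there exist $\eta>0,\theta_1>0$ such that for all $x,x'\in\mathbb R^n$, $\langle x-x',F(x)-F(x')\rangle\ge\eta\|x-x'\|^2$ and $\|F(x)-F(x')\|\le\theta_1\|x-x'\|$, and there exists $\theta_2>0$ such that for all $\mathbf y,\mathbf y'\in\mathbb R^{nN}$, $\|\mathcal F(\mathbf y)-\mathcal F(\mathbf y')\|\le\theta_2\|\mathbf y-\mathbf y'\|$. Suppose further that the positive step sizes satisfy $$\tau_{1i}^{-1}>\tfrac12\|A_i\|_1+(\tfrac12+\rho_\mu)d_i,\qquad \tau_{2i}^{-1}>\tfrac12\|A_i\|_\infty+(\tfrac12+\rho_z)d_i\quad\forall i\in\mathcal N,\qquad \tau_{3e}^{-1}>1,\quad\tau_{4e}^{-1}>1\quad\forall e\in\mathcal E_g,$$ and that $$\rho_\mu\ge\frac{2}{\sigma_1}\Big(\frac{(\theta_1+\theta_2)^2}{4\eta}+\theta_2\Big).$$ Then, for any initialization, the sequences $\{\mathbf y^{(k)}\}_{k\in\mathbb N}$ and $\{\boldsymbol\lambda^{(k)}\}_{k\in\mathbb N}$ generated by the distributed GNE seeking algorithm (described in the context) satisfy $\lim_{k\to\infty}\mathbf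 y^{(k)}=\mathbf 1_N\otimes y^*$ and $\lim_{k\to\infty}\boldsymbol\lambda^{(k)}=\mathbf 1_N\otimes\lambda^*$, where $y^*\in\mathbb R^n$ is a v-GNE of the game and $(y^*,\lambda^* )$ together solves the v-GNE KKT conditions.
   Context: Game. Players $\mathcal N=\{1,\dots,N\}$. Player $i$ has decision $x_i\in\Omega_i\subseteq\mathbb R^{n_i}$; $n=\sum_i n_i$, $x=[x_1;\dots;x_N]\in\mathbb R^n$, $x_{-i}$ is the stack of the other players' decisions. Given $x_{-i}$, player $i$ minimizes $J_i(x_i;x_{-i})$ (values in $\mathbb R\cup\{+\infty\}$) over $x_i\in\Omega_i$ subject to $A_ix_i\le b-\sum_{j\ne i}A_jx_j$, where $A_i\in\mathbb R^{m\times n_i}$, $b\in\mathbb R^m$. $A=[A_1,\dots,A_N]$, $\Omega=\prod_i\Omega_i$, $\mathcal X=\Omega\cap\{x: Ax-b\le\mathbf 0\}$. $N_S(x)$ is the normal cone of $S$ at $x$ (empty if $x\notin S$). The v-GNE KKT conditions for $(x,\lambda)$ are: $\mathbf 0\in\partial_{x_i}J_i(x_i;x_{-i})+A_i^T\lambda+N_{\Omega_i}(x_i)$ for all $i$, and $\mathbf 0\in-(Ax-b)+N_{\mathbb R_+^m}(\lambda)$; $x$ is a v-GNE (variational generalized Nash equilibrium) if some $\lambda$ makes them hold. Network. $\mathcal G=(\mathcal N,\mathcal E_g)$ is a directed graph on the players; $(j,i)$ denotes an edge with tail $j$ and head $i$. $\mathcal N_i^+=\{j:(j,i)\in\mathcal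 E_g\}$, $\mathcal N_i^-=\{j:(i,j)\in\mathcal E_g\}$; $\mathcal N_i$ is the collection of neighbors of $i$ (sums over $\mathcal N_i$ mean the sum over $\mathcal N_i^+$ plus the sum over $\mathcal N_i^-$); $d_i$ is the degree of $i$ (number of incident edges). $L=BB^T$ is the graph Laplacian, $B$ the incidence matrix ($+1$ at head, $-1$ at tail). $\sigma_1>0$ is the second smallest eigenvalue of $L$ (the smallest being $\sigma_0=0$). Notation. $y_i=(y_i^1,\dots,y_i^N)\in\mathbb R^n$, $y_i^j\in\mathbb R^{n_j}$, $y_i^{-i}$ is the stack of $y_i^j$, $j\ne i$; the same block notation $v^{i}$, $v^{-i}$ is used for any $v\in\mathbb R^n$. $\mathbf y=[y_1;\dots;y_N]$, $\boldsymbol\lambda=[\lambda_1;\dots;\lambda_N]$ with $\lambda_i\in\mathbb R^m$. $\mathcal R_iy_i=y_i^i$ (selection matrix). Pseudogradient: $F:x\mapsto[\partial_{x_i}J_i(x_i;x_{-i})]_{i\in\mathcal N}$ on $\mathbb R^n$; extended pseudogradient: $\mathcal F:\mathbf y\mapsto[\partial_{y_i^i}J_i(y_i^i;y_i^{-i})]_{i\in\mathcal N}$ from $\mathbb R^{nN}$ to $\mathbb R^n$ (both single-valued under Assumption 5). $\|\cdot\|_1,\|\cdot\|_\infty$ on matrices are the induced norms (max column / row absolute sum). $\rho_\mu,\rho_z\ge0$ are constants; $\tau_{1i},\tau_{2i}>0$ ($i\in\mathcal N$), $\tau_{3e},\tau_{4e}>0$ ($e\in\mathcal E_g$) are step sizes;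 $b_i\in\mathbb R^m$ are arbitrary fixed vectors with $\sum_ib_i=b$. Distributed GNE seeking algorithm. Initialize $\tilde y_i^{(0)}\in\mathbb R^n,\tilde\lambda_i^{(0)}\in\mathbb R^m$ ($i\in\mathcal N$), $\tilde\mu_{ji}^{(0)}\in\mathbb R^n,\tilde z_{ji}^{(0)}\in\mathbb R^m$ ($(j,i)\in\mathcal E_g$). For $k=0,1,\dots$: 1. For each player $i$: $$y_i^{-i(k+1)}=\tilde y_i^{-i(k)}-\tau_{1i}\Big(\tfrac{\rho_\mu}2\sum_{j\in\mathcal N_i}(\tilde y_i^{-i(k)}-\tilde y_j^{-i(k)})+\tfrac12\big(\sum_{j\in\mathcal N_i^+}\tilde\mu_{ji}^{-i(k)}-\sum_{j\in\mathcal N_i^-}\tilde\mu_{ij}^{-i(k)}\big)\Big),$$ $$y_i^{i(k+1)}=\mathrm{argmin}_{v_i\in\Omega_i}\Big[J_i(v_i;y_i^{-i(k+1)})+\tfrac12(\tilde\lambda_i^{(k)})^TA_iv_i+\tfrac{\rho_\mu}2\sum_{j\in\mathcal N_i}(\tilde y_i^{i(k)}-\tilde y_j^{i(k)})^Tv_i+\tfrac1{2\tau_{1i}}\|v_i-\tilde y_i^{i(k)}\|^2+\tfrac12\big(\sum_{j\in\mathcal N_i^+}\tilde\mu_{ji}^{i(k)}-\sum_{j\in\mathcal N_i^-}\tilde\mu_{ij}^{i(k)}\big)^Tv_i\Big],$$ $$\lambda_i^{(k+1)}=\mathrm{Proj}_{\mathbb R_+^m}\Big[\tilde\lambda_i^{(k)}+\tau_{2i}\Big(A_i\mathcal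 R_iy_i^{(k+1)}-\tfrac12A_i\mathcal R_i\tilde y_i^{(k)}-\tfrac{\rho_z}2\sum_{j\in\mathcal N_i}(\tilde\lambda_i^{(k)}-\tilde\lambda_j^{(k)})-\tfrac12\big(\sum_{j\in\mathcal N_i^+}\tilde z_{ji}^{(k)}-\sum_{j\in\mathcal N_i^-}\tilde z_{ij}^{(k)}\big)-b_i\Big)\Big].$$ 2. For each edge $e=(j,i)$: $\mu_{ji}^{(k+1)}=\tilde\mu_{ji}^{(k)}+\tau_{3e}\big(y_i^{(k+1)}-y_j^{(k+1)}-\frac12(\tilde y_i^{(k)}-\tilde y_j^{(k)})\big)$ and $z_{ji}^{(k+1)}=\tilde z_{ji}^{(k)}+\tau_{4e}\big(\lambda_i^{(k+1)}-\lambda_j^{(k+1)}-\frac12(\tilde\lambda_i^{(k)}-\tilde\lambda_j^{(k)})\big)$. 3. For each player $i$: $$\tilde y_i^{(k+1)}=y_i^{(k+1)}-\tau_{1i}\Big(\mathcal R_i^TA_i^T(\lambda_i^{(k+1)}-\tfrac12\tilde\lambda_i^{(k)})+\rho_\mu\sum_{j\in\mathcal N_i}\big((y_i^{(k+1)}-y_j^{(k+1)})-\tfrac12(\tilde y_i^{(k)}-\tilde y_j^{(k)})\big)+\sum_{j\in\mathcal N_i^+}(\mu_{ji}^{(k+1)}-\tfrac12\tilde\mu_{ji}^{(k)})-\sum_{j\in\mathcal N_i^-}(\mu_{ij}^{(k+1)}-\tfrac12\tilde\mu_{ij}^{(k)})\Big),$$ $$\tilde\lambda_i^{(k+1)}=\lambda_i^{(k+1)}+\tau_{2i}\Big(A_i\mathcal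 R_i(\tilde y_i^{(k+1)}-\tfrac12\tilde y_i^{(k)})-\rho_z\sum_{j\in\mathcal N_i}\big((\lambda_i^{(k+1)}-\lambda_j^{(k+1)})-\tfrac12(\tilde\lambda_i^{(k)}-\tilde\lambda_j^{(k)})\big)-\sum_{j\in\mathcal N_i^+}(z_{ji}^{(k+1)}-\tfrac12\tilde z_{ji}^{(k)})+\sum_{j\in\mathcal N_i^-}(z_{ij}^{(k+1)}-\tfrac12\tilde z_{ij}^{(k)})\Big).$$ 4. For each edge $e=(j,i)$: $\tilde\mu_{ji}^{(k+1)}=\mu_{ji}^{(k+1)}+\tau_{3e}\big(\tilde y_i^{(k+1)}-\tilde y_j^{(k+1)}-\frac12(\tilde y_i^{(k)}-\tilde y_j^{(k)})\big)$ and $\tilde z_{ji}^{(k+1)}=z_{ji}^{(k+1)}+\tau_{4e}\big(\tilde\lambda_i^{(k+1)}-\tilde\lambda_j^{(k+1)}-\frac12(\tilde\lambda_i^{(k)}-\tilde\lambda_j^{(k)})\big)$. *)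

theory Defs
  imports "HOL-Analysis.Analysis" "HOL-Library.Multiset"
begin

section \<open>Convex analysis for extended-real-valued functions\<close>

definition proper_fun :: "('a \<Rightarrow> ereal) \<Rightarrow> bool" where
  "proper_fun f \<longleftrightarrow> (\<forall>x. f x \<noteq> -\<infinity>) \<and> (\<exists>x. f x \<noteq> \<infinity>)"

definition lsc_fun :: "('a::topological_space \<Rightarrow> ereal) \<Rightarrow> bool" where
  "lsc_fun f \<longleftrightarrow> (\<forall>x. f x \<le> Liminf (at x) f)"

definition convex_fun :: "('a::real_vector \<Rightarrow> ereal) \<Rightarrow> bool" where
  "convex_fun f \<longleftrightarrow> convex {(x, r::real). f x \<le> ereal r}"

definition subdifferential :: "('a::real_inner \<Rightarrow> ereal) \<Rightarrow> 'a \<Rightarrow> 'a set" where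
  "subdifferential f x =
    {g. \<bar>f x\<bar> \<noteq> \<infinity> \<and> (\<forall>w. f x + ereal (g \<bullet> (w - x)) \<le> f w)}"

definition normal_cone :: "'a::real_inner set \<Rightarrow> 'a \<Rightarrow> 'a set" where
  "normal_cone S x = (if x \<in> S then {g. \<forall>w\<in>S. g \<bullet> (w - x) \<le> 0} else {})"

definition nonneg_orthant :: "(real^'m) set" where
  "nonneg_orthant = {l. \<forall>r. 0 \<le> l $ r}"


section \<open>The game\<close>

text \<open>
  Players are the elements of a finite type \<open>'p\<close>, the scalar coordinates of the joint decision
  \<open>x\<close> are the elements of a finite type \<open>'c\<close>, and \<open>owner G c\<close> is the player who controls the
  coordinate \<open>c\<close>; so the block dimension of player \<open>i\<close> is the number of coordinates owned by \<open>i\<close>,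
  and the block dimensions may differ.  The decision space of player \<open>i\<close> is identified with the
  coordinate subspace of all \<open>v\<close> with \<open>blk G i v = v\<close>.  The value \<open>cost G i x\<close> is
  \<open>J\<^sub>i(x\<^sub>i; x\<^sub>-\<^sub>i)\<close> as a function of the joint decision.
\<close>

record ('p, 'c::finite, 'm::finite) game =
  owner :: "'c \<Rightarrow> 'p"
  cost :: "'p \<Rightarrow> real^'c \<Rightarrow> ereal"
  local_set :: "'p \<Rightarrow> (real^'c) set"
  cmat :: "real^'c^'m"
  cvec :: "real^'m"

definition blk :: "('p, 'c::finite, 'm::finite) game \<Rightarrow> 'p \<Rightarrow> real^'c \<Rightarrow> real^'c" where
  "blk G i v = (\<chi> c. if owner G c = i then v $ c else 0)"

text \<open>\<open>join G i v x\<close> has block \<open>i\<close> from \<open>v\<close> and all other blocks from \<open>x\<close>.\<close>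

definition join :: "('p, 'c::finite, 'm::finite) game \<Rightarrow> 'p \<Rightarrow> real^'c \<Rightarrow> real^'c \<Rightarrow> real^'c" where
  "join G i v x = (\<chi> c. if owner G c = i then v $ c else x $ c)"

text \<open>
  \<open>cblk G i\<close> is \<open>A\<^sub>i\<close>, padded with zero columns to the width of \<open>A\<close>; the padding changes neither
  of the two induced norms below.
\<close>

definition cblk :: "('p, 'c::finite, 'm::finite) game \<Rightarrow> 'p \<Rightarrow> real^'c^'m" where
  "cblk G i = (\<chi> r c. if owner G c = i then cmat G $ r $ c else 0)"

definition mat_norm1 :: "real^'c^'m \<Rightarrow> real" where
  "mat_norm1 M = Max (range (\<lambda>c. \<Sum>r\<in>UNIV. \<bar>M $ r $ c\<bar>))"

definition mat_norm_inf :: "real^'c^'m \<Rightarrow> real" where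
  "mat_norm_inf M = Max (range (\<lambda>r. \<Sum>c\<in>UNIV. \<bar>M $ r $ c\<bar>))"

definition joint_set :: "('p, 'c::finite, 'm::finite) game \<Rightarrow> (real^'c) set" where
  "joint_set G = {x. \<forall>i. blk G i x \<in> local_set G i}"

definition feasible_set :: "('p, 'c::finite, 'm::finite) game \<Rightarrow> (real^'c) set" where
  "feasible_set G = joint_set G \<inter> {x. \<forall>r. (cmat G *v x - cvec G) $ r \<le> 0}"

definition slater :: "('p, 'c::finite, 'm::finite) game \<Rightarrow> bool" where
  "slater G \<longleftrightarrow> (\<exists>x\<in>joint_set G. \<forall>r. (cmat G *v x - cvec G) $ r < 0)"

text \<open>
  \<open>partial_subdiff G i x\<close> is the partial subdifferential of \<open>J\<^sub>i\<close> with respect to \<open>x\<^sub>i\<close> at \<open>x\<close>.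
  The function below does not depend on the coordinates outside block \<open>i\<close>, so its subgradients
  vanish there.
\<close>

definition partial_subdiff ::
  "('p, 'c::finite, 'm::finite) game \<Rightarrow> 'p \<Rightarrow> real^'c \<Rightarrow> (real^'c) set" where
  "partial_subdiff G i x = subdifferential (\<lambda>v. cost G i (join G i v x)) x"

definition pseudogradient ::
  "('p, 'c::finite, 'm::finite) game \<Rightarrow> real^'c \<Rightarrow> (real^'c) set" where
  "pseudogradient G x = {g. \<forall>i. blk G i g \<in> partial_subdiff G i x}"

definition ext_pseudogradient ::
  "('p::finite, 'c::finite, 'm::finite) game \<Rightarrow> (real^'c)^'p \<Rightarrow> (real^'c) set" where
  "ext_pseudogradient G Y = {g. \<forall>i. blk G i g \<in> partial_subdiff G i (Y $ i)}"

text \<open>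
  When \<open>local_set G i\<close> lies in the decision space of player \<open>i\<close>, the ambient normal cone below
  additionally contains vectors with nonzero coordinates outside block \<open>i\<close>; these cannot take part
  in a zero sum, because the other two terms vanish outside block \<open>i\<close>.
\<close>

definition vgne_kkt ::
  "('p, 'c::finite, 'm::finite) game \<Rightarrow> real^'c \<Rightarrow> real^'m \<Rightarrow> bool" where
  "vgne_kkt G x l \<longleftrightarrow>
    (\<forall>i. 0 \<in> {g + transpose (cblk G i) *v l + n | g n.
                g \<in> partial_subdiff G i x \<and> n \<in> normal_cone (local_set G i) (blk G i x)}) \<and>
    0 \<in> {- (cmat G *v x - cvec G) + n | n. n \<in> normal_cone nonneg_orthant l}"

definition is_vgne :: "('p, 'c::finite, 'm::finite) game \<Rightarrow> real^'c \<Rightarrow> bool" where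
  "is_vgne G x \<longleftrightarrow> (\<exists>l. vgne_kkt G x l)"


section \<open>The network\<close>

text \<open>A directed graph on the players is its edge set; \<open>(j, i)\<close> has tail \<open>j\<close> and head \<open>i\<close>.\<close>

definition nb_in :: "('p \<times> 'p) set \<Rightarrow> 'p \<Rightarrow> 'p set" where
  "nb_in E i = {j. (j, i) \<in> E}"

definition nb_out :: "('p \<times> 'p) set \<Rightarrow> 'p \<Rightarrow> 'p set" where
  "nb_out E i = {j. (i, j) \<in> E}"

definition degree_of :: "('p \<times> 'p) set \<Rightarrow> 'p \<Rightarrow> nat" where
  "degree_of E i = card {e \<in> E. fst e = i \<or> snd e = i}"

definition weakly_connected :: "('p \<times> 'p) set \<Rightarrow> bool" where
  "weakly_connected E \<longleftrightarrow> (\<forall>i j. (i, j) \<in> (E \<union> E\<inverse>)\<^sup>*)"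

definition nb_sum :: "('p \<times> 'p) set \<Rightarrow> 'p \<Rightarrow> ('p \<Rightarrow> 'a::real_vector) \<Rightarrow> 'a" where
  "nb_sum E i f = (\<Sum>j\<in>nb_in E i. f j) + (\<Sum>j\<in>nb_out E i. f j)"

definition net_inflow :: "('p \<times> 'p) set \<Rightarrow> 'p \<Rightarrow> ('p \<times> 'p \<Rightarrow> 'a::real_vector) \<Rightarrow> 'a" where
  "net_inflow E i f = (\<Sum>j\<in>nb_in E i. f (j, i)) - (\<Sum>j\<in>nb_out E i. f (i, j))"

text \<open>
  The columns are indexed by all pairs of players; the columns of pairs that are not edges are
  zero and do not contribute to the Laplacian.
\<close>

definition incidence :: "('p::finite \<times> 'p) set \<Rightarrow> real^('p \<times> 'p)^'p" where
  "incidence E =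
    (\<chi> i e. if e \<in> E then (if snd e = i then 1 else if fst e = i then -1 else 0) else 0)"

definition laplacian :: "('p::finite \<times> 'p) set \<Rightarrow> real^'p^'p" where
  "laplacian E = incidence E ** transpose (incidence E)"

definition eigenspace :: "real^'n^'n \<Rightarrow> real \<Rightarrow> (real^'n) set" where
  "eigenspace M s = {v. M *v v = s *\<^sub>R v}"

definition eigenvalues :: "real^'n^'n \<Rightarrow> real set" where
  "eigenvalues M = {s. eigenspace M s \<noteq> {0}}"

text \<open>
  The ascending list of the eigenvalues of a symmetric matrix, each one repeated according to its
  multiplicity (the dimension of its eigenspace).
\<close>

definition sorted_spectrum :: "real^'n^'n \<Rightarrow> real list" where
  "sorted_spectrum M =
    sorted_list_of_multiset (\<Sum>s\<in>eigenvalues M. replicate_mset (dim (eigenspace M s)) s)"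

text \<open>For a \<open>1 \<times> 1\<close> matrix the list has length one and the value below is unspecified.\<close>

definition second_smallest_eigenvalue :: "real^'n^'n \<Rightarrow> real" where
  "second_smallest_eigenvalue M = sorted_spectrum M ! 1"


section \<open>The algorithm\<close>

record ('p, 'm::finite) params =
  rho_mu :: real
  rho_z :: real
  tau1 :: "'p \<Rightarrow> real"
  tau2 :: "'p \<Rightarrow> real"
  tau3 :: "'p \<times> 'p \<Rightarrow> real"
  tau4 :: "'p \<times> 'p \<Rightarrow> real"
  bvec :: "'p \<Rightarrow> real^'m"

text \<open>
  The edge variables \<open>\<mu>\<close> and \<open>z\<close> are total functions on pairs of players; their values
  at pairs that are not edges are never used.
\<close>

record ('p::finite, 'c::finite, 'm::finite) iterate =
  yv :: "(real^'c)^'p"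
  lv :: "(real^'m)^'p"
  mv :: "'p \<times> 'p \<Rightarrow> real^'c"
  zv :: "'p \<times> 'p \<Rightarrow> real^'m"

text \<open>
  In the following four definitions \<open>t\<close> is the tilde iterate with index \<open>k\<close>.  With the decision
  spaces embedded as above, \<open>blk G i\<close> plays the role both of \<open>\<R>\<^sub>i\<close> and of its transpose.
\<close>

definition y_explicit ::
  "('p \<times> 'p) set \<Rightarrow> ('p, 'm) params \<Rightarrow> ('p::finite, 'c::finite, 'm::finite) iterate \<Rightarrow>
   'p \<Rightarrow> real^'c" where
  "y_explicit E P t i = yv t $ i - tau1 P i *\<^sub>R
     ((rho_mu P / 2) *\<^sub>R nb_sum E i (\<lambda>j. yv t $ i - yv t $ j)
      + (1/2) *\<^sub>R net_inflow E i (mv t))"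

definition y_objective ::
  "('p, 'c, 'm) game \<Rightarrow> ('p \<times> 'p) set \<Rightarrow> ('p, 'm) params \<Rightarrow>
   ('p::finite, 'c::finite, 'm::finite) iterate \<Rightarrow> 'p \<Rightarrow> real^'c \<Rightarrow> ereal" where
  "y_objective G E P t i v =
     cost G i (join G i v (y_explicit E P t i))
     + ereal ((1/2) * (lv t $ i \<bullet> (cblk G i *v v))
              + (rho_mu P / 2) * (nb_sum E i (\<lambda>j. blk G i (yv t $ i - yv t $ j)) \<bullet> v)
              + (1 / (2 * tau1 P i)) * (norm (v - blk G i (yv t $ i)))\<^sup>2
              + (1/2) * (blk G i (net_inflow E i (mv t)) \<bullet> v))"

definition main_step ::
  "('p, 'c, 'm) game \<Rightarrow> ('p \<times> 'p) set \<Rightarrow> ('p, 'm) params \<Rightarrow>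
   ('p::finite, 'c::finite, 'm::finite) iterate \<Rightarrow> ('p, 'c, 'm) iterate" where
  "main_step G E P t =
    (let y = (\<chi> i. join G i (arg_min_on (y_objective G E P t i) (local_set G i))
                          (y_explicit E P t i));
         l = (\<chi> i. closest_point nonneg_orthant
               (lv t $ i + tau2 P i *\<^sub>R
                 (cblk G i *v blk G i (y $ i) - (1/2) *\<^sub>R (cblk G i *v blk G i (yv t $ i))
                  - (rho_z P / 2) *\<^sub>R nb_sum E i (\<lambda>j. lv t $ i - lv t $ j)
                  - (1/2) *\<^sub>R net_inflow E i (zv t)
                  - bvec P i)))
     in \<lparr> yv = y, lv = l,
          mv = (\<lambda>(j, i). mv t (j, i) + tau3 P (j, i) *\<^sub>R
                  (y $ i - y $ j - (1/2) *\<^sub>R (yv t $ i - yv t $ j))),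
          zv = (\<lambda>(j, i). zv t (j, i) + tau4 P (j, i) *\<^sub>R
                  (l $ i - l $ j - (1/2) *\<^sub>R (lv t $ i - lv t $ j))) \<rparr>)"

text \<open>Here \<open>s = main_step G E P t\<close> is the iterate with index \<open>k + 1\<close>; the result is the tilde
  iterate with index \<open>k + 1\<close>.\<close>

definition tilde_step ::
  "('p, 'c, 'm) game \<Rightarrow> ('p \<times> 'p) set \<Rightarrow> ('p, 'm) params \<Rightarrow>
   ('p::finite, 'c::finite, 'm::finite) iterate \<Rightarrow> ('p, 'c, 'm) iterate" where
  "tilde_step G E P t =
    (let s = main_step G E P t;
         yt = (\<chi> i. yv s $ i - tau1 P i *\<^sub>R
                (blk G i (transpose (cblk G i) *v (lv s $ i - (1/2) *\<^sub>R lv t $ i))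
                 + rho_mu P *\<^sub>R nb_sum E i
                     (\<lambda>j. (yv s $ i - yv s $ j) - (1/2) *\<^sub>R (yv t $ i - yv t $ j))
                 + net_inflow E i (\<lambda>e. mv s e - (1/2) *\<^sub>R mv t e)));
         lt = (\<chi> i. lv s $ i + tau2 P i *\<^sub>R
                (cblk G i *v blk G i (yt $ i - (1/2) *\<^sub>R yv t $ i)
                 - rho_z P *\<^sub>R nb_sum E i
                     (\<lambda>j. (lv s $ i - lv s $ j) - (1/2) *\<^sub>R (lv t $ i - lv t $ j))
                 - net_inflow E i (\<lambda>e. zv s e - (1/2) *\<^sub>R zv t e)))
     in \<lparr> yv = yt, lv = lt,
          mv = (\<lambda>(j, i). mv s (j, i) + tau3 P (j, i) *\<^sub>R
                  (yt $ i - yt $ j - (1/2) *\<^sub>R (yv t $ i - yv t $ j))),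
          zv = (\<lambda>(j, i). zv s (j, i) + tau4 P (j, i) *\<^sub>R
                  (lt $ i - lt $ j - (1/2) *\<^sub>R (lv t $ i - lv t $ j))) \<rparr>)"

definition tilde_seq ::
  "('p, 'c, 'm) game \<Rightarrow> ('p \<times> 'p) set \<Rightarrow> ('p, 'm) params \<Rightarrow>
   ('p::finite, 'c::finite, 'm::finite) iterate \<Rightarrow> nat \<Rightarrow> ('p, 'c, 'm) iterate" where
  "tilde_seq G E P init k = (tilde_step G E P ^^ k) init"

text \<open>
  The algorithm only generates the non-tilde variables with index at least one:
  \<open>main_seq G E P init k\<close> consists of those with index \<open>k + 1\<close>.
\<close>

definition main_seq ::
  "('p, 'c, 'm) game \<Rightarrow> ('p \<times> 'p) set \<Rightarrow> ('p, 'm) params \<Rightarrow>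
   ('p::finite, 'c::finite, 'm::finite) iterate \<Rightarrow> nat \<Rightarrow> ('p, 'c, 'm) iterate" where
  "main_seq G E P init k = main_step G E P (tilde_seq G E P init k)"

end

theory Submission
  imports Defs
begin

text \<open>
  Collect the variables of all players and edges into one state \<open>(y, l, m, z)\<close>.  The KKT conditions,
  written with a private copy of the decision and of the multiplier for every player, ask for a zero
  of the sum of two maps: the relation \<open>game_relation\<close>, which gathers the partial gradients and the
  normal cones of the local constraints, and the linear map \<open>coupling\<close>.  The skew part of
  \<open>coupling\<close> pairs the primal with the dual variables, and its symmetric part consists of the
  Laplacians weighted by \<open>rho_mu\<close> and \<open>rho_z\<close>.

  The coupling is split in two halves: \<open>A\<close> is \<open>game_relation\<close> plus half of the coupling and \<open>B\<close> is
  the other half.  One round of the algorithm is one Douglas-Rachford step for \<open>A + B\<close> in the inner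
  product given by \<open>precond\<close>: the first two stages are the resolvent of \<open>A\<close>
  (\<open>main_step_inclusion\<close>), the last two are the resolvent of \<open>B\<close> (\<open>tilde_step_equation\<close>).  The
  off-diagonal part of \<open>precond\<close> is chosen so that each resolvent can be evaluated block after
  block.  The bounds on the step sizes say that \<open>precond\<close> is diagonally dominant, hence positive
  definite (\<open>precond_positive_definite\<close>).

  The map \<open>A\<close> need not be monotone, because a player's partial gradient is taken at a private
  estimate of the decisions of the others.  The convergence proof of the splitting, however, uses
  the monotonicity inequality only between an arbitrary point and a zero of \<open>A + B\<close>
  (\<open>preconditioned_douglas_rachford_converges\<close>).  At a zero all copies agree, since the graph is
  connected, and against such a point the inequality holds
  (\<open>extended_pseudogradient_restricted_monotone\<close>): strong monotonicity controls the average of the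
  estimates, and half of the Laplacian term, at least \<open>rho_mu / 2\<close> times the second smallest
  eigenvalue times the squared disagreement, pays for everything that the disagreement may spoil.

  A zero exists.  The variational inequality of the strongly monotone pseudogradient over the
  feasible set has a solution, as a fixed point of a contraction; Slater's condition
  provides a multiplier for the shared constraint (\<open>kkt_point_exists\<close>); and the local residuals of
  the shared constraint, which balance once every player has taken an equal share of the total, are
  routed through the connected graph by edge variables (\<open>consensus_zero_of_kkt_point\<close>).  Conversely, the edge variables cancel when the
  equations of a zero are summed over the players, so that the limit satisfies the KKT conditions
  (\<open>consensus_zero_imp_kkt\<close>).
\<close>

section \<open>Preconditioned Douglas-Rachford iteration\<close>

text \<open>
  The form attains a positive minimum on the unit sphere, and homogeneity spreads it to all vectors.
\<close>

lemma positive_definite_coercive: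
  fixes Q :: "'a::euclidean_space \<Rightarrow> 'a"
  assumes lin: "linear Q" and pos: "\<And>x. x \<noteq> 0 \<Longrightarrow> 0 < x \<bullet> Q x"
  obtains c where "0 < c" "\<And>x. c * (norm x)\<^sup>2 \<le> x \<bullet> Q x"
proof -
  have cont: "continuous_on (sphere 0 1) (\<lambda>x. x \<bullet> Q x)"
    using lin by (intro continuous_intros linear_continuous_on) (simp add: linear_conv_bounded_linear)
  have ne: "sphere (0::'a) 1 \<noteq> {}"
    by simp
  obtain u where u: "u \<in> sphere 0 1" "\<And>x. x \<in> sphere 0 1 \<Longrightarrow> u \<bullet> Q u \<le> x \<bullet> Q x"
    using continuous_attains_inf[OF compact_sphere ne cont] by blast
  show ?thesis
  proof (rule that[of "u \<bullet> Q u"])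
    show "0 < u \<bullet> Q u"
      using u(1) by (intro pos) auto
    show "u \<bullet> Q u * (norm x)\<^sup>2 \<le> x \<bullet> Q x" for x
    proof (cases "x = 0")
      case False
      have "u \<bullet> Q u \<le> (x /\<^sub>R norm x) \<bullet> Q (x /\<^sub>R norm x)"
        using False by (intro u(2)) auto
      also have "\<dots> = (x \<bullet> Q x) / (norm x)\<^sup>2"
        by (simp add: linear_cmul[OF lin] power2_eq_square divide_simps)
      finally show ?thesis
        using False by (simp add: field_simps)
    qed simp
  qed
qed

text \<open>
  One step does not move away from a point \<open>s\<close> that belongs to a zero \<open>z\<close> of the sum of two maps \<open>A\<close>
  and \<open>B\<close>.  The first claim adds the monotonicity inequality for \<open>A\<close> between \<open>w\<close> and \<open>z\<close> to the
  one for \<open>B\<close> between \<open>w + t' - t\<close> and \<open>z\<close>, both expanded in the inner product of \<open>Q\<close>; the second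
  claim comes from the inequality for \<open>A\<close> alone.
\<close>

lemma douglas_rachford_fejer:
  fixes Q B :: "'a::euclidean_space \<Rightarrow> 'a"
  assumes lin: "linear Q" and sym: "\<And>x y. Q x \<bullet> y = x \<bullet> Q y"
    and pos: "\<And>x. 0 \<le> x \<bullet> Q x"
    and linB: "linear B" and monoB: "\<And>x. 0 \<le> x \<bullet> B x"
    and A: "0 \<le> (w - z) \<bullet> (Q (t - w) + B z)"
    and B: "Q (w - t') = B (w + t' - t)"
    and s: "Q (s - z) = - B z"
  shows "(t' - s) \<bullet> Q (t' - s) + (t' - t) \<bullet> Q (t' - t) \<le> (t - s) \<bullet> Q (t - s)"
    and "(w - z) \<bullet> Q (w - z) \<le> (t - s) \<bullet> Q (t - s)"
proof -
  define a where "a = w - z"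
  define b where "b = t - s"
  define d where "d = t' - t"
  note Q_simps = linear_add[OF lin] linear_diff[OF lin] linear_neg[OF lin]
    inner_add_left inner_add_right inner_diff_left inner_diff_right
  have comm: "y \<bullet> Q x = x \<bullet> Q y" for x y
    using sym[of x y] by (simp add: inner_commute)
  have Bz: "B z = Q z - Q s"
    using arg_cong[OF s, of uminus] by (simp add: linear_diff[OF lin])
  have "Q (t - w) + B z = Q (b - a)"
    by (simp add: Bz a_def b_def linear_diff[OF lin])
  then have 1: "0 \<le> a \<bullet> Q (b - a)"
    using A by (simp add: a_def)
  have "B (a + d) = B (w + t' - t) - B z"
    by (simp add: a_def d_def linear_diff[OF linB] linear_add[OF linB])
  also have "\<dots> = Q (a - b - d)"
    unfolding B[symmetric] by (simp add: Bz a_def b_def d_def linear_diff[OF lin] linear_add[OF lin])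
  finally have 2: "0 \<le> (a + d) \<bullet> Q (a - b - d)"
    using monoB[of "a + d"] by simp
  have t': "t' - s = b + d"
    by (simp add: b_def d_def)
  show "(t' - s) \<bullet> Q (t' - s) + (t' - t) \<bullet> Q (t' - t) \<le> (t - s) \<bullet> Q (t - s)"
    using 1 2 comm[of a b] comm[of a d] comm[of b d]
    unfolding t' b_def[symmetric] d_def[symmetric] by (simp add: Q_simps)
  show "(w - z) \<bullet> Q (w - z) \<le> (t - s) \<bullet> Q (t - s)"
    using 1 pos[of "a - b"] comm[of a b]
    unfolding a_def[symmetric] b_def[symmetric] by (simp add: Q_simps)
qed

text \<open>
  A Douglas-Rachford iteration in the inner product of \<open>Q\<close>, where monotonicity of \<open>A\<close> is required
  only against zeros of \<open>A + B\<close>.  By the Fejer inequality the iterates are bounded and the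
  increments vanish, so a cluster point solves both resolvent equations because \<open>A\<close> is closed; it is
  therefore a zero.  The Fejer inequality with respect to this particular zero turns the cluster point
  into a limit.  Without full monotonicity the resolvent of \<open>A\<close> can be multivalued and discontinuous,
  so \<open>t\<close> and \<open>w\<close> are arbitrary sequences that solve the resolvent equations, and limits are taken in the
  closed graph.
\<close>

theorem preconditioned_douglas_rachford_converges:
  fixes Q B :: "'a::euclidean_space \<Rightarrow> 'a" and A :: "('a \<times> 'a) set"
  assumes lin: "linear Q" and sym: "\<And>x y. Q x \<bullet> y = x \<bullet> Q y"
    and pos: "\<And>x. x \<noteq> 0 \<Longrightarrow> 0 < x \<bullet> Q x"
    and linB: "linear B" and monoB: "\<And>x. 0 \<le> x \<bullet> B x"
    and closedA: "closed A"
    and monoA: "\<And>x a z. (x, a) \<in> A \<Longrightarrow> (z, - B z) \<in> A \<Longrightarrow> 0 \<le> (x - z) \<bullet> (a + B z)"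
    and zero: "(z0, - B z0) \<in> A"
    and stepA: "\<And>k. (w k, Q (t k - w k)) \<in> A"
    and stepB: "\<And>k. Q (w k - t (Suc k)) = B (w k + t (Suc k) - t k)"
  obtains z where "(z, - B z) \<in> A" "w \<longlonglongrightarrow> z"
proof -
  have pos0: "0 \<le> x \<bullet> Q x" for x
    using pos[of x] by (cases "x = 0") auto
  obtain c where c: "0 < c" "\<And>x. c * (norm x)\<^sup>2 \<le> x \<bullet> Q x"
    using positive_definite_coercive[OF lin pos] by blast
  have small: "u \<longlonglongrightarrow> 0" if "(\<lambda>k. u k \<bullet> Q (u k)) \<longlonglongrightarrow> 0" for u :: "nat \<Rightarrow> 'a"
  proof -
    have "(\<lambda>k. (norm (u k))\<^sup>2) \<longlonglongrightarrow> 0"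
    proof (rule tendsto_sandwich[where f = "\<lambda>_. 0"])
      show "(\<lambda>k. (u k \<bullet> Q (u k)) / c) \<longlonglongrightarrow> 0"
        using tendsto_divide[OF that tendsto_const[of c]] c(1) by simp
      show "\<forall>\<^sub>F k in sequentially. (norm (u k))\<^sup>2 \<le> (u k \<bullet> Q (u k)) / c"
        using c by (simp add: field_simps)
    qed auto
    then have "(\<lambda>k. sqrt ((norm (u k))\<^sup>2)) \<longlonglongrightarrow> sqrt 0"
      by (intro tendsto_real_sqrt)
    then show ?thesis
      by (simp add: tendsto_norm_zero_iff)
  qed
  have bounded: "bounded (range u)" if "\<And>k. u k \<bullet> Q (u k) \<le> C" for u :: "nat \<Rightarrow> 'a" and C
  proof -
    have "norm (u k) \<le> sqrt (C / c)" for k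
      using c(2)[of "u k"] that[of k] c(1) by (intro real_le_rsqrt) (simp add: field_simps)
    then show ?thesis
      unfolding bounded_iff by auto
  qed
  have surj: "surj Q"
  proof (rule linear_injective_imp_surjective[OF lin])
    show "inj Q"
      unfolding linear_injective_0[OF lin] using pos by fastforce
  qed simp
  have contQ: "isCont Q x" and contB: "isCont B x" for x
    using lin linB by (simp_all add: linear_continuous_at linear_conv_bounded_linear)
  have fejer:
    "(t (Suc k) - s) \<bullet> Q (t (Suc k) - s) + (t (Suc k) - t k) \<bullet> Q (t (Suc k) - t k)
       \<le> (t k - s) \<bullet> Q (t k - s)"
    "(w k - z) \<bullet> Q (w k - z) \<le> (t k - s) \<bullet> Q (t k - s)"
    if "(z, - B z) \<in> A" "Q (s - z) = - B z" for s z k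
    using douglas_rachford_fejer[OF lin sym pos0 linB monoB monoA[OF stepA that(1)] stepB that(2)]
    by blast+
  have dec: "decseq (\<lambda>k. (t k - s) \<bullet> Q (t k - s))"
    if "(z, - B z) \<in> A" "Q (s - z) = - B z" for s z
  proof (rule decseq_SucI)
    show "(t (Suc k) - s) \<bullet> Q (t (Suc k) - s) \<le> (t k - s) \<bullet> Q (t k - s)" for k
      using fejer(1)[OF that, of k] pos0[of "t (Suc k) - t k"] by linarith
  qed
  obtain s0 where s0: "Q (s0 - z0) = - B z0"
  proof -
    obtain r where "Q r = - B z0"
      using surj by (metis surjD)
    then show ?thesis
      by (intro that[of "r + z0"]) simp
  qed
  \<comment> \<open>Fejer distance to the given zero: it decreases, and its decrements bound the increments of \<open>t\<close>.\<close>
  let ?V = "\<lambda>k. (t k - s0) \<bullet> Q (t k - s0)"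
  obtain l where l: "?V \<longlonglongrightarrow> l"
    by (rule decseq_convergent[OF dec[OF zero s0], of 0]) (use pos0 in auto)
  have inc: "(\<lambda>k. t (Suc k) - t k) \<longlonglongrightarrow> 0"
  proof (rule small, rule tendsto_sandwich[where f = "\<lambda>_. 0"])
    show "(\<lambda>k. ?V k - ?V (Suc k)) \<longlonglongrightarrow> 0"
      using tendsto_diff[OF l LIMSEQ_Suc[OF l]] by simp
    show "\<forall>\<^sub>F k in sequentially. (t (Suc k) - t k) \<bullet> Q (t (Suc k) - t k) \<le> ?V k - ?V (Suc k)"
      using fejer(1)[OF zero s0] by (intro always_eventually allI) (simp add: algebra_simps)
  qed (use pos0 in auto)
  have V0: "?V k \<le> ?V 0" for k
    using dec[OF zero s0] by (simp add: decseq_def)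
  have "bounded (range (\<lambda>k. t k - s0))"
    using V0 by (rule bounded)
  moreover have "bounded (range (\<lambda>k. w k - z0))"
    using order_trans[OF fejer(2)[OF zero s0] V0] by (rule bounded)
  ultimately have "bounded (range (\<lambda>k. t k - s0) \<times> range (\<lambda>k. w k - z0))"
    by (rule bounded_Times)
  then have "bounded (range (\<lambda>k. (t k - s0, w k - z0)))"
    by (rule bounded_subset) auto
  then obtain p r where r: "strict_mono r"
    and lim: "((\<lambda>k. (t k - s0, w k - z0)) \<circ> r) \<longlonglongrightarrow> p"
    using bounded_imp_convergent_subsequence by blast
  define s where "s = fst p + s0"
  define z where "z = snd p + z0"
  have ts: "(\<lambda>k. t (r k)) \<longlonglongrightarrow> s"
    using tendsto_add[OF tendsto_fst[OF lim] tendsto_const[of s0]] by (simp add: s_def o_def)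
  have wz: "(\<lambda>k. w (r k)) \<longlonglongrightarrow> z"
    using tendsto_add[OF tendsto_snd[OF lim] tendsto_const[of z0]] by (simp add: z_def o_def)
  have incr: "(\<lambda>k. t (Suc (r k)) - t (r k)) \<longlonglongrightarrow> 0"
    using LIMSEQ_subseq_LIMSEQ[OF inc r] by (simp add: o_def)
  \<comment> \<open>The two resolvent equations pass to the limit along the subsequence.\<close>
  have "(\<lambda>k. Q (w (r k) - t (r k) - (t (Suc (r k)) - t (r k)))) \<longlonglongrightarrow> Q (z - s - 0)"
    by (intro isCont_tendsto_compose[OF contQ] tendsto_intros ts wz incr)
  moreover have "(\<lambda>k. B (w (r k) + (t (Suc (r k)) - t (r k)))) \<longlonglongrightarrow> B (z + 0)"
    by (intro isCont_tendsto_compose[OF contB] tendsto_intros wz incr)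
  ultimately have "Q (z - s) = B z"
    using LIMSEQ_unique stepB by (simp add: algebra_simps)
  then have s: "Q (s - z) = - B z"
    using linear_neg[OF lin, of "z - s"] by simp
  have "(\<lambda>k. (w (r k), Q (t (r k) - w (r k)))) \<longlonglongrightarrow> (z, - B z)"
    unfolding s[symmetric]
    by (intro tendsto_Pair isCont_tendsto_compose[OF contQ] tendsto_intros ts wz)
  then have z: "(z, - B z) \<in> A"
    by (rule closed_sequentially[OF closedA, rotated]) (rule stepA)
  \<comment> \<open>Fejer distance to the cluster point: a subsequence tends to zero, hence so does the whole sequence.\<close>
  let ?W = "\<lambda>k. (t k - s) \<bullet> Q (t k - s)"
  obtain l' where l': "?W \<longlonglongrightarrow> l'"
    by (rule decseq_convergent[OF dec[OF z s], of 0]) (use pos0 in auto)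
  have "(\<lambda>k. ?W (r k)) \<longlonglongrightarrow> (s - s) \<bullet> Q (s - s)"
    by (intro tendsto_inner isCont_tendsto_compose[OF contQ] tendsto_intros ts)
  moreover have "(\<lambda>k. ?W (r k)) \<longlonglongrightarrow> l'"
    using LIMSEQ_subseq_LIMSEQ[OF l' r] by (simp add: o_def)
  ultimately have "l' = 0"
    using LIMSEQ_unique by fastforce
  then have W0: "?W \<longlonglongrightarrow> 0"
    using l' by simp
  have "(\<lambda>k. w k - z) \<longlonglongrightarrow> 0"
  proof (rule small, rule tendsto_sandwich[where f = "\<lambda>_. 0"])
    show "?W \<longlonglongrightarrow> 0"
      by (rule W0)
    show "\<forall>\<^sub>F k in sequentially. (w k - z) \<bullet> Q (w k - z) \<le> ?W k"
      using fejer(2)[OF z s] by simp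
  qed (use pos0 in auto)
  then have "w \<longlonglongrightarrow> z"
    by (simp add: LIM_zero_iff)
  with z show ?thesis
    by (rule that)
qed

section \<open>Differences along edges and net inflow\<close>

text \<open>
  The transpose of the incidence matrix, acting on vectors with entries in any vector space; edge
  vectors are indexed by all pairs of players and vanish outside the graph.
\<close>

definition edge_diff :: "('p \<times> 'p) set \<Rightarrow> 'a::real_vector^'p \<Rightarrow> 'a^('p \<times> 'p::finite)" where
  "edge_diff E y = (\<chi> e. if e \<in> E then y $ snd e - y $ fst e else 0)"

definition inflow :: "('p \<times> 'p) set \<Rightarrow> 'a::real_vector^('p \<times> 'p) \<Rightarrow> 'a^('p::finite)" where
  "inflow E m = (\<chi> i. net_inflow E i (\<lambda>e. m $ e))"

lemma sum_nb_in: "(\<Sum>j\<in>nb_in E i. f (j, i)) = (\<Sum>e\<in>E. if snd e = i then f e else 0)"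
  for E :: "('p::finite \<times> 'p) set" and f :: "'p \<times> 'p \<Rightarrow> 'a::real_vector"
proof -
  have "(\<Sum>j\<in>nb_in E i. f (j, i)) = (\<Sum>e\<in>{e \<in> E. snd e = i}. f e)"
    by (rule sum.reindex_bij_witness[of _ fst "\<lambda>j. (j, i)"]) (auto simp: nb_in_def)
  then show ?thesis
    by (simp add: sum.inter_filter)
qed

lemma sum_nb_out: "(\<Sum>j\<in>nb_out E i. f (i, j)) = (\<Sum>e\<in>E. if fst e = i then f e else 0)"
  for E :: "('p::finite \<times> 'p) set" and f :: "'p \<times> 'p \<Rightarrow> 'a::real_vector"
proof -
  have "(\<Sum>j\<in>nb_out E i. f (i, j)) = (\<Sum>e\<in>{e \<in> E. fst e = i}. f e)"
    by (rule sum.reindex_bij_witness[of _ snd "\<lambda>j. (i, j)"]) (auto simp: nb_out_def)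
  then show ?thesis
    by (simp add: sum.inter_filter)
qed

lemma net_inflow_eq_sum_edges:
  "net_inflow E i f = (\<Sum>e\<in>E. (if snd e = i then f e else 0) - (if fst e = i then f e else 0))"
  for E :: "('p::finite \<times> 'p) set" and f :: "'p \<times> 'p \<Rightarrow> 'a::real_vector"
  by (simp add: net_inflow_def sum_nb_in sum_nb_out sum_subtractf)

lemma inflow_edge_diff: "inflow E (edge_diff E y) $ i = nb_sum E i (\<lambda>j. y $ i - y $ j)"
proof -
  have "(\<Sum>j\<in>nb_in E i. edge_diff E y $ (j, i)) = (\<Sum>j\<in>nb_in E i. y $ i - y $ j)"
    by (rule sum.cong) (auto simp: nb_in_def edge_diff_def)
  moreover have "(\<Sum>j\<in>nb_out E i. edge_diff E y $ (i, j)) = - (\<Sum>j\<in>nb_out E i. y $ i - y $ j)"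
    unfolding sum_negf[symmetric] by (rule sum.cong) (auto simp: nb_out_def edge_diff_def)
  ultimately show ?thesis
    by (simp add: inflow_def net_inflow_def nb_sum_def)
qed

lemma linear_edge_diff: "linear (edge_diff E)"
  by (rule linearI) (auto simp: edge_diff_def vec_eq_iff scaleR_diff_right)

lemma linear_inflow: "linear (inflow E)"
  by (rule linearI)
    (simp_all add: inflow_def vec_eq_iff net_inflow_def sum.distrib scaleR_sum_right scaleR_diff_right)

text \<open>
  Summation by parts on the graph: each edge contributes once at its head and once, with the opposite
  sign, at its tail.
\<close>

lemma inner_inflow: "y \<bullet> inflow E m = edge_diff E y \<bullet> m"
  for y :: "'a::real_inner^'p::finite"
proof -
  have "y \<bullet> inflow E m = (\<Sum>i\<in>UNIV. \<Sum>e\<in>E. (if snd e = i then y $ i \<bullet> m $ e else 0)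
      - (if fst e = i then y $ i \<bullet> m $ e else 0))"
    unfolding inner_vec_def inflow_def net_inflow_eq_sum_edges
    by (intro sum.cong) (auto simp: inner_sum_right inner_diff_right intro!: sum.cong)
  also have "\<dots> = (\<Sum>e\<in>E. \<Sum>i\<in>UNIV. (if snd e = i then y $ i \<bullet> m $ e else 0)
      - (if fst e = i then y $ i \<bullet> m $ e else 0))"
    by (rule sum.swap)
  also have "\<dots> = (\<Sum>e\<in>E. (y $ snd e - y $ fst e) \<bullet> m $ e)"
    by (simp add: sum_subtractf inner_diff_left)
  also have "\<dots> = edge_diff E y \<bullet> m"
    unfolding inner_vec_def edge_diff_def by (rule sum.mono_neutral_cong_left) auto
  finally show ?thesis .
qed

lemma sum_inflow: "(\<Sum>i\<in>UNIV. inflow E m $ i) = 0"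
proof -
  have "(\<Sum>i\<in>UNIV. inflow E m $ i)
      = (\<Sum>e\<in>E. \<Sum>i\<in>UNIV. (if snd e = i then m $ e else 0) - (if fst e = i then m $ e else 0))"
    unfolding inflow_def net_inflow_eq_sum_edges by (simp, rule sum.swap)
  also have "\<dots> = 0"
    by (simp add: sum_subtractf)
  finally show ?thesis .
qed

lemma inflow_axis:
  assumes "e \<in> E"
  shows "inflow E (axis e u) $ k = (if k = snd e then u else 0) - (if k = fst e then u else 0)"
proof -
  have "inflow E (axis e u) $ k
      = (\<Sum>e'\<in>E. if e' = e then (if k = snd e then u else 0) - (if k = fst e then u else 0) else 0)"
    unfolding inflow_def net_inflow_eq_sum_edges vec_lambda_beta
    by (rule sum.cong) (auto simp: axis_def)
  then show ?thesis
    using assms by simp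
qed

text \<open>
  Demands that sum to zero can be routed through a connected graph.  A demand \<open>v\<close> at \<open>i\<close> and \<open>- v\<close>
  at \<open>j\<close> is routed along a path; all demands are routed to one common node, where they cancel.
\<close>

lemma inflow_surjective_on_balanced:
  fixes f :: "'a::real_vector^'p::finite"
  assumes conn: "weakly_connected E" and bal: "(\<Sum>i\<in>UNIV. f $ i) = 0"
  obtains m where "inflow E m = f"
proof -
  have transport: "\<exists>m. \<forall>k. inflow E m $ k = (if k = i then v else 0) - (if k = j then v else 0)"
    if "(i, j) \<in> (E \<union> E\<inverse>)\<^sup>*" for i j and v :: 'a
    using that
  proof (induction rule: rtrancl_induct)
    case base
    show ?case
      by (rule exI[of _ 0]) (simp add: linear_0[OF linear_inflow])
  next
    case (step j l)
    then obtain m where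
      m: "\<And>k. inflow E m $ k = (if k = i then v else 0) - (if k = j then v else 0)"
      by blast
    from step.hyps(2) consider "(j, l) \<in> E" | "(l, j) \<in> E"
      by auto
    then show ?case
    proof cases
      case 1
      show ?thesis
        by (rule exI[of _ "m + axis (j, l) (- v)"])
          (simp add: linear_add[OF linear_inflow] m inflow_axis[OF 1])
    next
      case 2
      show ?thesis
        by (rule exI[of _ "m + axis (l, j) v"])
          (simp add: linear_add[OF linear_inflow] m inflow_axis[OF 2])
    qed
  qed
  \<comment> \<open>The node to which all demands are routed.\<close>
  obtain r :: 'p where True
    by blast
  have "\<forall>i. \<exists>m. \<forall>k. inflow E m $ k = (if k = i then f $ i else 0) - (if k = r then f $ i else 0)"
    using transport conn unfolding weakly_connected_def by blast
  then obtain m where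
    m: "\<And>i k. inflow E (m i) $ k = (if k = i then f $ i else 0) - (if k = r then f $ i else 0)"
    by metis
  have "inflow E (\<Sum>i\<in>UNIV. m i) $ k = f $ k" for k
    by (cases "k = r") (simp_all add: linear_sum[OF linear_inflow] m sum_subtractf bal)
  then show ?thesis
    by (intro that[of "\<Sum>i\<in>UNIV. m i"]) (simp add: vec_eq_iff)
qed

lemma edge_diff_eq_0_imp_consensus:
  assumes conn: "weakly_connected E" and zero: "edge_diff E y = 0"
  obtains a where "y = (\<chi> i. a)"
proof -
  have edge: "y $ i = y $ j" if "(i, j) \<in> E" for i j
    using arg_cong[OF zero, of "\<lambda>m. m $ (i, j)"] that by (simp add: edge_diff_def)
  have "y $ i = y $ j" if "(i, j) \<in> (E \<union> E\<inverse>)\<^sup>*" for i j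
    using that by (induction rule: rtrancl_induct) (auto dest: edge)
  then have "y $ i = y $ j" for i j
    using conn unfolding weakly_connected_def by blast
  then show ?thesis
    by (intro that[of "y $ undefined"]) (simp add: vec_eq_iff)
qed

lemma edge_diff_const [simp]: "edge_diff E (\<chi> i. a) = 0"
  by (simp add: edge_diff_def vec_eq_iff)

text \<open>
  Double counting of incidences; an edge that is not a loop is counted at two different nodes.
\<close>

lemma sum_degree:
  fixes E :: "('p::finite \<times> 'p) set" and h :: "'p \<Rightarrow> real"
  assumes "irrefl E"
  shows "(\<Sum>i\<in>UNIV. real (degree_of E i) * h i) = (\<Sum>e\<in>E. h (fst e) + h (snd e))"
proof -
  have "(\<Sum>i\<in>UNIV. real (degree_of E i) * h i)
      = (\<Sum>i\<in>UNIV. \<Sum>e\<in>E. if fst e = i \<or> snd e = i then h i else 0)"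
    by (simp add: degree_of_def sum.inter_filter[symmetric])
  also have "\<dots> = (\<Sum>e\<in>E. \<Sum>i\<in>UNIV. if fst e = i \<or> snd e = i then h i else 0)"
    by (rule sum.swap)
  also have "\<dots> = (\<Sum>e\<in>E. h (fst e) + h (snd e))"
  proof (rule sum.cong)
    fix e assume "e \<in> E"
    then have "fst e \<noteq> snd e"
      using assms by (cases e) (auto simp: irrefl_def)
    moreover have "(\<Sum>i\<in>UNIV. if fst e = i \<or> snd e = i then h i else 0) = sum h {fst e, snd e}"
      by (subst sum.inter_filter[symmetric]) (auto intro!: sum.cong)
    ultimately show "(\<Sum>i\<in>UNIV. if fst e = i \<or> snd e = i then h i else 0) = h (fst e) + h (snd e)"
      by simp
  qed simp
  finally show ?thesis .
qed

lemma norm_sq_vec: "(norm x)\<^sup>2 = (\<Sum>i\<in>UNIV. (norm (x $ i))\<^sup>2)"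
  for x :: "'a::real_inner^'n"
  by (simp add: power2_norm_eq_inner inner_vec_def)

lemma norm_edge_diff_le:
  fixes y :: "'a::real_inner^'p::finite"
  assumes "irrefl E"
  shows "(norm (edge_diff E y))\<^sup>2 \<le> 2 * (\<Sum>i\<in>UNIV. real (degree_of E i) * (norm (y $ i))\<^sup>2)"
proof -
  have "(norm (edge_diff E y))\<^sup>2 = (\<Sum>e\<in>E. (norm (y $ snd e - y $ fst e))\<^sup>2)"
    unfolding norm_sq_vec edge_diff_def by (rule sum.mono_neutral_cong_right) auto
  also have "\<dots> \<le> (\<Sum>e\<in>E. 2 * ((norm (y $ fst e))\<^sup>2 + (norm (y $ snd e))\<^sup>2))"
  proof (rule sum_mono)
    show "(norm (y $ snd e - y $ fst e))\<^sup>2 \<le> 2 * ((norm (y $ fst e))\<^sup>2 + (norm (y $ snd e))\<^sup>2)" for e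
      using inner_ge_zero[of "y $ snd e + y $ fst e"]
      by (simp add: power2_norm_eq_inner inner_simps inner_commute)
  qed
  also have "\<dots> = 2 * (\<Sum>i\<in>UNIV. real (degree_of E i) * (norm (y $ i))\<^sup>2)"
    unfolding sum_degree[OF assms] by (simp add: sum_distrib_left)
  finally show ?thesis .
qed

lemma inner_edge_diff_le:
  fixes y :: "'a::real_inner^'p::finite"
  assumes "irrefl E"
  shows "edge_diff E y \<bullet> m
    \<le> 1/2 * (\<Sum>i\<in>UNIV. real (degree_of E i) * (norm (y $ i))\<^sup>2) + (\<Sum>e\<in>E. (norm (m $ e))\<^sup>2)"
proof -
  have "edge_diff E y \<bullet> m = (\<Sum>e\<in>E. (y $ snd e - y $ fst e) \<bullet> m $ e)"
    unfolding inner_vec_def edge_diff_def by (rule sum.mono_neutral_cong_right) auto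
  also have "\<dots> \<le> (\<Sum>e\<in>E. 1/2 * ((norm (y $ fst e))\<^sup>2 + (norm (y $ snd e))\<^sup>2) + (norm (m $ e))\<^sup>2)"
  proof (rule sum_mono)
    show "(y $ snd e - y $ fst e) \<bullet> m $ e
      \<le> 1/2 * ((norm (y $ fst e))\<^sup>2 + (norm (y $ snd e))\<^sup>2) + (norm (m $ e))\<^sup>2" for e
      using inner_ge_zero[of "y $ snd e - m $ e"] inner_ge_zero[of "y $ fst e + m $ e"]
      by (simp add: power2_norm_eq_inner inner_simps inner_commute add_divide_distrib)
  qed
  also have "\<dots> = 1/2 * (\<Sum>i\<in>UNIV. real (degree_of E i) * (norm (y $ i))\<^sup>2) + (\<Sum>e\<in>E. (norm (m $ e))\<^sup>2)"
    unfolding sum_degree[OF assms]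
    by (simp add: sum.distrib sum_divide_distrib[symmetric])
  finally show ?thesis .
qed

section \<open>The spectrum of the graph Laplacian\<close>

lemma incidence_mult: "irrefl E \<Longrightarrow> incidence E *v m = inflow E m"
  for m :: "real^('p::finite \<times> 'p)"
proof -
  assume "irrefl E"
  then have ne: "fst e \<noteq> snd e" if "e \<in> E" for e
    using that by (cases e) (auto simp: irrefl_def)
  have "(incidence E *v m) $ i = inflow E m $ i" for i
    unfolding inflow_def net_inflow_eq_sum_edges matrix_vector_mult_def incidence_def vec_lambda_beta
    by (rule sum.mono_neutral_cong_right) (auto dest: ne)
  then show ?thesis
    by (simp add: vec_eq_iff)
qed

lemma transpose_incidence_mult: "irrefl E \<Longrightarrow> transpose (incidence E) *v x = edge_diff E x"
  for x :: "real^'p::finite"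
proof -
  assume "irrefl E"
  then have "(transpose (incidence E) *v x) \<bullet> m = edge_diff E x \<bullet> m" for m
    by (metis dot_lmul_matrix vector_transpose_matrix transpose_transpose incidence_mult inner_inflow)
  then show ?thesis
    by (metis vector_eq_rdot)
qed

lemma laplacian_mult: "irrefl E \<Longrightarrow> laplacian E *v x = inflow E (edge_diff E x)"
  by (metis laplacian_def matrix_vector_mul_assoc incidence_mult transpose_incidence_mult)

lemma inner_laplacian: "irrefl E \<Longrightarrow> x \<bullet> (laplacian E *v y) = edge_diff E x \<bullet> edge_diff E y"
  by (simp add: laplacian_mult inner_inflow)

text \<open>
  Eigenvectors for different eigenvalues of a symmetric matrix are orthogonal, hence independent.
\<close>

lemma finite_eigenvalues_symmetric:
  fixes M :: "real^'n^'n"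
  assumes sym: "\<And>x y. x \<bullet> (M *v y) = y \<bullet> (M *v x)"
  shows "finite (eigenvalues M)"
proof -
  have "\<exists>v. v \<noteq> 0 \<and> M *v v = s *\<^sub>R v" if "s \<in> eigenvalues M" for s
    using that unfolding eigenvalues_def eigenspace_def by fastforce
  then obtain v where v: "\<And>s. s \<in> eigenvalues M \<Longrightarrow> v s \<noteq> 0"
    "\<And>s. s \<in> eigenvalues M \<Longrightarrow> M *v v s = s *\<^sub>R v s"
    by metis
  have inj: "inj_on v (eigenvalues M)"
  proof (rule inj_onI)
    fix s t assume "s \<in> eigenvalues M" "t \<in> eigenvalues M" "v s = v t"
    then have "s *\<^sub>R v s = t *\<^sub>R v s"
      using v(2) by metis
    then show "s = t"
      using v(1)[OF \<open>s \<in> eigenvalues M\<close>] by simp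
  qed
  have "pairwise orthogonal (v ` eigenvalues M)"
  proof (clarsimp simp: pairwise_def orthogonal_def)
    fix s t assume s: "s \<in> eigenvalues M" and t: "t \<in> eigenvalues M" and "v s \<noteq> v t"
    have "t * (v s \<bullet> v t) = s * (v s \<bullet> v t)"
      using sym[of "v s" "v t"] v(2)[OF s] v(2)[OF t] by (simp add: inner_commute)
    then show "v s \<bullet> v t = 0"
      using \<open>v s \<noteq> v t\<close> by auto
  qed
  then have "independent (v ` eigenvalues M)"
    using v(1) by (intro pairwise_orthogonal_independent) auto
  then have "finite (v ` eigenvalues M)"
    using independent_imp_finite by blast
  then show ?thesis
    using inj by (rule finite_imageD)
qed

text \<open>
  Finiteness matters here: the sum that defines the spectrum is empty by convention over an infinite set.
\<close>

lemma count_sorted_spectrum: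
  assumes "finite (eigenvalues M)"
  shows "count (mset (sorted_spectrum M)) s = (if s \<in> eigenvalues M then dim (eigenspace M s) else 0)"
  using assms by (simp add: sorted_spectrum_def count_sum)

text \<open>
  The minimum of the Rayleigh quotient over the vectors of mean zero is attained by compactness, and a
  minimizer is an eigenvector: its residual has mean zero again, so a small step against a nonzero
  residual would lower the quotient.
\<close>

lemma rayleigh_minimizer:
  fixes E :: "('p::finite \<times> 'p) set"
  assumes irr: "irrefl E" and card: "CARD('p) > 1"
  obtains u :: "real^'p" and m where "norm u = 1" "(\<Sum>i\<in>UNIV. u $ i) = 0" "laplacian E *v u = m *\<^sub>R u"
    "\<And>x :: real^'p. (\<Sum>i\<in>UNIV. x $ i) = 0 \<Longrightarrow> m * (norm x)\<^sup>2 \<le> (norm (edge_diff E x))\<^sup>2"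
proof -
  let ?K = "sphere 0 1 \<inter> {x :: real^'p. (\<Sum>i\<in>UNIV. x $ i) = 0}"
  have cpt: "compact ?K"
    by (intro compact_Int_closed compact_sphere closed_Collect_eq continuous_intros)
  obtain i j :: 'p where ij: "i \<noteq> j"
    using card by (metis card_2_iff' card_le_Suc0_iff_eq finite not_less One_nat_def UNIV_I)
  define d :: "real^'p" where "d = axis i 1 - axis j 1"
  have d0: "d \<noteq> 0"
    using ij by (auto simp: d_def vec_eq_iff axis_def dest: spec[of _ i])
  have dsum: "(\<Sum>k\<in>UNIV. d $ k) = 0"
    by (simp add: d_def sum_subtractf axis_def)
  have "d /\<^sub>R norm d \<in> ?K"
    using d0 dsum by (simp add: sum_distrib_left[symmetric] sum_divide_distrib[symmetric])
  then have ne: "?K \<noteq> {}"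
    by blast
  have cont: "continuous_on ?K (\<lambda>x. (norm (edge_diff E x))\<^sup>2)"
    by (intro continuous_intros linear_continuous_on)
      (simp add: linear_conv_bounded_linear[symmetric] linear_edge_diff)
  obtain u where u: "u \<in> ?K"
    and min: "\<And>x. x \<in> ?K \<Longrightarrow> (norm (edge_diff E u))\<^sup>2 \<le> (norm (edge_diff E x))\<^sup>2"
    using continuous_attains_inf[OF cpt ne cont] by blast
  define m where "m = (norm (edge_diff E u))\<^sup>2"
  have low: "m * (norm x)\<^sup>2 \<le> (norm (edge_diff E x))\<^sup>2"
    if x: "(\<Sum>i\<in>UNIV. x $ i) = 0" for x :: "real^'p"
  proof (cases "x = 0")
    case False
    have "m \<le> (norm (edge_diff E (x /\<^sub>R norm x)))\<^sup>2"
      unfolding m_def using False x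
      by (intro min) (simp add: sum_distrib_left[symmetric] sum_divide_distrib[symmetric])
    also have "\<dots> = (norm (edge_diff E x))\<^sup>2 / (norm x)\<^sup>2"
      by (simp add: linear_cmul[OF linear_edge_diff] power_mult_distrib power_inverse divide_inverse)
    finally show ?thesis
      using False by (simp add: field_simps)
  qed simp
  define r where "r = laplacian E *v u - m *\<^sub>R u"
  define q where "q = (norm (edge_diff E r))\<^sup>2 - m * (norm r)\<^sup>2"
  have rsum: "(\<Sum>i\<in>UNIV. r $ i) = 0"
    using u by (simp add: r_def sum_subtractf laplacian_mult[OF irr] sum_inflow sum_distrib_left[symmetric])
  have q0: "0 \<le> q"
    using low[OF rsum] by (simp add: q_def)
  \<comment> \<open>The quadratic form is nonnegative along the residual and vanishes at the minimizer.\<close>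
  have quad: "0 \<le> t\<^sup>2 * q + 2 * t * (norm r)\<^sup>2" for t :: real
  proof -
    have "(\<Sum>i\<in>UNIV. (u + t *\<^sub>R r) $ i) = 0"
      using u rsum by (simp add: sum.distrib sum_distrib_left[symmetric])
    from low[OF this] have
      "m * ((u + t *\<^sub>R r) \<bullet> (u + t *\<^sub>R r)) \<le> (u + t *\<^sub>R r) \<bullet> (laplacian E *v (u + t *\<^sub>R r))"
      by (simp add: power2_norm_eq_inner inner_laplacian[OF irr])
    moreover have "(u + t *\<^sub>R r) \<bullet> (laplacian E *v (u + t *\<^sub>R r))
        = u \<bullet> (laplacian E *v u) + 2 * t * (r \<bullet> (laplacian E *v u)) + t\<^sup>2 * (r \<bullet> (laplacian E *v r))"
      by (simp add: inner_laplacian[OF irr] linear_add[OF linear_edge_diff]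
          linear_cmul[OF linear_edge_diff] inner_simps inner_commute power2_eq_square algebra_simps)
    moreover have "u \<bullet> (laplacian E *v u) = m" "u \<bullet> u = 1"
      using u by (simp_all add: inner_laplacian[OF irr] m_def power2_norm_eq_inner norm_eq_1)
    moreover have "r \<bullet> (laplacian E *v u) = (norm r)\<^sup>2 + m * (r \<bullet> u)"
      by (simp add: r_def power2_norm_eq_inner inner_simps inner_commute algebra_simps)
    moreover have "r \<bullet> (laplacian E *v r) = q + m * (r \<bullet> r)"
      by (simp add: q_def inner_laplacian[OF irr] power2_norm_eq_inner)
    ultimately show ?thesis
      by (simp add: inner_simps inner_commute power2_eq_square algebra_simps)
  qed
  have "r = 0"
  proof (rule ccontr)
    assume "r \<noteq> 0"
    define a where "a = (norm r)\<^sup>2"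
    have a: "a > 0"
      using \<open>r \<noteq> 0\<close> by (simp add: a_def)
    \<comment> \<open>A step short enough for the linear term to outweigh the quadratic one; \<open>q\<close> itself may be zero.\<close>
    define s where "s = a / (q + 1)"
    have s: "s > 0" "s * q \<le> a"
      using a q0 by (auto simp: s_def field_simps)
    have "0 \<le> s * (s * q - 2 * a)"
      using quad[of "- s"] unfolding a_def[symmetric] by (simp add: power2_eq_square algebra_simps)
    then show False
      using a s by (simp add: zero_le_mult_iff)
  qed
  then have "laplacian E *v u = m *\<^sub>R u"
    by (simp add: r_def)
  then show ?thesis
    using u low by (intro that[of u m]) auto
qed

text \<open>
  The eigenvalue zero is simple because the graph is connected, and all eigenvalues are nonnegative.
  The restricted Rayleigh minimum is a nonzero eigenvalue, hence occurs behind the leading zero in the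
  sorted list and is bounded below by the second entry.
\<close>

lemma second_smallest_eigenvalue_laplacian:
  fixes E :: "('p::finite \<times> 'p) set"
  assumes irr: "irrefl E" and conn: "weakly_connected E" and card: "CARD('p) > 1"
  shows "0 < second_smallest_eigenvalue (laplacian E)"
    and "\<And>x :: real^'p. (\<Sum>i\<in>UNIV. x $ i) = 0 \<Longrightarrow>
      second_smallest_eigenvalue (laplacian E) * (norm x)\<^sup>2 \<le> (norm (edge_diff E x))\<^sup>2"
proof -
  let ?L = "laplacian E" and ?l = "sorted_spectrum (laplacian E)"
  obtain u :: "real^'p" and m where u: "norm u = 1" "(\<Sum>i\<in>UNIV. u $ i) = 0" "?L *v u = m *\<^sub>R u"
    and low: "\<And>x :: real^'p. (\<Sum>i\<in>UNIV. x $ i) = 0 \<Longrightarrow> m * (norm x)\<^sup>2 \<le> (norm (edge_diff E x))\<^sup>2"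
    using rayleigh_minimizer[OF irr card] by blast
  have fin: "finite (eigenvalues ?L)"
    by (rule finite_eigenvalues_symmetric) (simp add: inner_laplacian[OF irr] inner_commute)
  have eig: "s \<in> eigenvalues ?L \<longleftrightarrow> (\<exists>v. v \<noteq> 0 \<and> ?L *v v = s *\<^sub>R v)" for s
    unfolding eigenvalues_def eigenspace_def by fastforce
  have set: "set ?l = eigenvalues ?L"
  proof -
    have "dim (eigenspace ?L s) \<noteq> 0" if "s \<in> eigenvalues ?L" for s
      using that unfolding eigenvalues_def dim_eq_0 eigenspace_def by fastforce
    then have "s \<in> set ?l \<longleftrightarrow> s \<in> eigenvalues ?L" for s
      unfolding set_mset_mset[symmetric] count_greater_zero_iff[symmetric] count_sorted_spectrum[OF fin]
      by (simp del: dim_eq_0)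
    then show ?thesis
      by (intro set_eqI)
  qed
  have nonneg: "0 \<le> s" if "s \<in> set ?l" for s
  proof -
    have "\<exists>v. v \<noteq> 0 \<and> ?L *v v = s *\<^sub>R v"
      using that by (simp only: set eig)
    then obtain v where v: "v \<noteq> 0" "?L *v v = s *\<^sub>R v"
      by (elim exE conjE)
    have "s * (v \<bullet> v) = edge_diff E v \<bullet> edge_diff E v"
      using v(2) inner_laplacian[OF irr, of v v] by simp
    then show ?thesis
      using v(1) by (metis inner_ge_zero inner_gt_zero_iff zero_le_mult_iff not_less)
  qed
  have ker: "eigenspace ?L 0 = span {\<chi> i. 1}"
  proof
    show "eigenspace ?L 0 \<subseteq> span {\<chi> i. 1}"
    proof
      fix v assume "v \<in> eigenspace ?L 0"
      then have "edge_diff E v \<bullet> edge_diff E v = 0"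
        unfolding inner_laplacian[OF irr, symmetric] by (simp add: eigenspace_def)
      then obtain a where "v = (\<chi> i. a)"
        using edge_diff_eq_0_imp_consensus[OF conn, of v] by auto
      then have "v = a *\<^sub>R (\<chi> i. 1)"
        by (simp add: vec_eq_iff)
      then show "v \<in> span {\<chi> i. 1}"
        by (simp add: span_mul span_base)
    qed
    have "(\<chi> i. 1) \<in> eigenspace ?L 0"
      by (simp add: eigenspace_def laplacian_mult[OF irr] linear_0[OF linear_inflow])
    then show "span {\<chi> i. 1} \<subseteq> eigenspace ?L 0"
      by (auto simp: span_singleton eigenspace_def matrix_vector_mult_scaleR)
  qed
  have one: "(\<chi> i. 1) \<noteq> (0 :: real^'p)"
    by (simp add: vec_eq_iff)
  have "dim (eigenspace ?L 0) = 1"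
    unfolding ker dim_span using one by (subst dim_eq_card_independent) (auto simp: dependent_single)
  then have count0: "count (mset ?l) 0 \<le> 1"
    unfolding count_sorted_spectrum[OF fin] by simp
  have zero_in: "0 \<in> set ?l"
    unfolding set eig by (rule exI[of _ "\<chi> i. 1"])
      (simp add: one laplacian_mult[OF irr] linear_0[OF linear_inflow])
  have m_in: "m \<in> set ?l"
    unfolding set eig using u by (intro exI[of _ u]) auto
  have m0: "m \<noteq> 0"
  proof
    assume "m = 0"
    then have "u \<in> span {\<chi> i. 1}"
      using u(3) unfolding ker[symmetric] by (simp add: eigenspace_def)
    then obtain a where "u = a *\<^sub>R (\<chi> i. 1)"
      by (auto simp: span_singleton)
    then show False
      using u(1,2) by simp
  qed
  have sorted: "sorted ?l"
    by (simp add: sorted_spectrum_def)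
  obtain a b xs where l: "?l = a # b # xs"
    using zero_in m_in m0 by (cases ?l rule: remdups_adj.cases) auto
  have "a = 0"
    using zero_in nonneg[of a] sorted unfolding l by (auto intro: antisym)
  moreover have "b \<noteq> 0"
    using count0 \<open>a = 0\<close> unfolding l by auto
  ultimately have "0 < b" "b \<le> m"
    using nonneg[of b] sorted m_in m0 unfolding l by auto
  moreover have b: "second_smallest_eigenvalue ?L = b"
    by (simp add: second_smallest_eigenvalue_def l)
  ultimately show "0 < second_smallest_eigenvalue ?L"
    by simp
  show "second_smallest_eigenvalue ?L * (norm x)\<^sup>2 \<le> (norm (edge_diff E x))\<^sup>2"
    if "(\<Sum>i\<in>UNIV. x $ i) = 0" for x :: "real^'p"
    unfolding b using low[OF that] \<open>b \<le> m\<close> mult_right_mono[of b m "(norm x)\<^sup>2"] by simp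
qed

lemma algebraic_connectivity_vector:
  fixes y :: "(real^'c)^'p::finite"
  assumes irr: "irrefl E" and conn: "weakly_connected E" and card: "CARD('p) > 1"
    and mean: "(\<Sum>i\<in>UNIV. y $ i) = 0"
  shows "second_smallest_eigenvalue (laplacian E) * (norm y)\<^sup>2 \<le> (norm (edge_diff E y))\<^sup>2"
proof -
  define col where "col = (\<lambda>c. \<chi> i. y $ i $ c)"
  have "(norm y)\<^sup>2 = (\<Sum>c\<in>UNIV. (norm (col c))\<^sup>2)"
    unfolding norm_sq_vec col_def by (simp, rule sum.swap)
  moreover have "(norm (edge_diff E y))\<^sup>2 = (\<Sum>c\<in>UNIV. (norm (edge_diff E (col c)))\<^sup>2)"
  proof -
    have "edge_diff E (col c) $ e = edge_diff E y $ e $ c" for e c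
      by (simp add: edge_diff_def col_def)
    then show ?thesis
      unfolding norm_sq_vec by (simp, subst sum.swap) simp
  qed
  moreover have "(\<Sum>i\<in>UNIV. col c $ i) = 0" for c
    using arg_cong[OF mean, of "\<lambda>v. v $ c"] by (simp add: col_def)
  ultimately show ?thesis
    using second_smallest_eigenvalue_laplacian(2)[OF irr conn card]
    by (simp add: sum_distrib_left sum_mono)
qed

section \<open>Variational inequalities and multipliers\<close>

text \<open>
  For the step \<open>\<eta> / \<theta>\<^sup>2\<close> the projected gradient map is a contraction, and its fixed point solves
  the inequality.
\<close>

lemma variational_inequality_solution:
  fixes F :: "'a::euclidean_space \<Rightarrow> 'a"
  assumes S: "closed S" "convex S" "S \<noteq> {}" and pos: "\<eta> > 0" "\<theta> > 0"
    and mono: "\<And>x y. (x - y) \<bullet> (F x - F y) \<ge> \<eta> * (norm (x - y))\<^sup>2"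
    and lip: "\<And>x y. norm (F x - F y) \<le> \<theta> * norm (x - y)"
  obtains x where "x \<in> S" "\<And>w. w \<in> S \<Longrightarrow> 0 \<le> F x \<bullet> (w - x)"
proof -
  define g where "g = \<eta> / \<theta>\<^sup>2"
  define T where "T x = closest_point S (x - g *\<^sub>R F x)" for x
  define c where "c = sqrt (max 0 (1 - g * \<eta>))"
  have g: "g > 0"
    using pos by (simp add: g_def)
  have c1: "0 \<le> c" "c < 1"
    using g pos by (auto simp: c_def)
  have "dist (T x) (T y) \<le> c * dist x y" for x y
  proof -
    have "(norm (F x - F y))\<^sup>2 \<le> \<theta>\<^sup>2 * (norm (x - y))\<^sup>2"
      using power_mono[OF lip[of x y] norm_ge_zero, of 2] by (simp add: power_mult_distrib)
    then have "g\<^sup>2 * (norm (F x - F y))\<^sup>2 \<le> g\<^sup>2 * (\<theta>\<^sup>2 * (norm (x - y))\<^sup>2)"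
      by (rule mult_left_mono) simp
    also have "\<dots> = g * \<eta> * (norm (x - y))\<^sup>2"
      using pos by (simp add: g_def power2_eq_square)
    finally have 1: "g\<^sup>2 * (norm (F x - F y))\<^sup>2 \<le> g * \<eta> * (norm (x - y))\<^sup>2" .
    have 2: "g * (\<eta> * (norm (x - y))\<^sup>2) \<le> g * ((x - y) \<bullet> (F x - F y))"
      using mono g by (intro mult_left_mono) auto
    have "(norm ((x - g *\<^sub>R F x) - (y - g *\<^sub>R F y)))\<^sup>2 = (norm ((x - y) - g *\<^sub>R (F x - F y)))\<^sup>2"
      by (simp add: algebra_simps)
    also have "\<dots> = (norm (x - y))\<^sup>2 - 2 * (g * ((x - y) \<bullet> (F x - F y))) + g\<^sup>2 * (norm (F x - F y))\<^sup>2"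
      unfolding power2_norm_eq_inner
      by (simp add: inner_simps inner_commute power2_eq_square algebra_simps)
    also have "\<dots> \<le> (1 - g * \<eta>) * (norm (x - y))\<^sup>2"
      using 1 2 by (simp add: algebra_simps)
    also have "\<dots> \<le> max 0 (1 - g * \<eta>) * (norm (x - y))\<^sup>2"
      by (intro mult_right_mono) auto
    also have "\<dots> = (c * norm (x - y))\<^sup>2"
      by (simp add: c_def power_mult_distrib)
    finally have "norm ((x - g *\<^sub>R F x) - (y - g *\<^sub>R F y)) \<le> c * norm (x - y)"
      by (rule power2_le_imp_le) (use c1 in simp)
    then show ?thesis
      unfolding T_def using closest_point_lipschitz[OF S(2,1,3), of "x - g *\<^sub>R F x" "y - g *\<^sub>R F y"]
      by (simp add: dist_norm)
  qed
  then obtain x where x: "T x = x"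
    using banach_fix_type[of c T] c1 by blast
  show ?thesis
  proof (rule that)
    show "x \<in> S"
      using closest_point_in_set[OF S(1,3)] x unfolding T_def by metis
    show "0 \<le> F x \<bullet> (w - x)" if "w \<in> S" for w
      using closest_point_dot[OF S(2,1) that, of "x - g *\<^sub>R F x"] g
      unfolding T_def[symmetric] x by (simp add: zero_le_mult_iff)
  qed
qed

lemma slope_nonneg:
  fixes c d :: real
  assumes "\<And>n. n \<ge> 0 \<Longrightarrow> 0 \<le> c + n * d"
  shows "0 \<le> d"
proof (rule ccontr)
  assume "\<not> 0 \<le> d"
  then have "(\<bar>c\<bar> + 1) / (- d) * d = - (\<bar>c\<bar> + 1)" "0 \<le> (\<bar>c\<bar> + 1) / (- d)"
    by (simp_all add: field_simps)
  then show False
    using assms[of "(\<bar>c\<bar> + 1) / (- d)"] by linarith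
qed

text \<open>
  Linear duality under Slater's condition.  The set of pairs \<open>(t, s)\<close> that some admissible \<open>w\<close>
  improves upon is convex and avoids the origin; a separating functional is nonnegative, and
  the Slater point forces its first component to be positive.
\<close>

lemma lagrange_multiplier:
  fixes A :: "real^'c^'m" and b :: "real^'m"
  assumes S: "convex S"
    and x: "x \<in> S" "\<And>r. (A *v x - b) $ r \<le> 0"
    and slater: "x0 \<in> S" "\<And>r. (A *v x0 - b) $ r < 0"
    and opt: "\<And>w. w \<in> S \<Longrightarrow> (\<And>r. (A *v w - b) $ r \<le> 0) \<Longrightarrow> 0 \<le> g \<bullet> (w - x)"
  obtains l where "\<And>r. 0 \<le> l $ r" "l \<bullet> (A *v x - b) = 0"
    "\<And>w. w \<in> S \<Longrightarrow> 0 \<le> (g + transpose A *v l) \<bullet> (w - x)"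
proof -
  define C where "C = {(t, s). \<exists>w\<in>S. g \<bullet> (w - x) < t \<and> (\<forall>r. (A *v w - b) $ r \<le> s $ r)}"
  have "convex C"
  proof (rule convexI)
    fix p q :: "real \<times> (real^'m)" and u v :: real
    assume p: "p \<in> C" and q: "q \<in> C" and uv: "0 \<le> u" "0 \<le> v" "u + v = 1"
    obtain w where w: "w \<in> S" "g \<bullet> (w - x) < fst p" "\<And>r. (A *v w - b) $ r \<le> snd p $ r"
      using p by (auto simp: C_def)
    obtain w' where w': "w' \<in> S" "g \<bullet> (w' - x) < fst q" "\<And>r. (A *v w' - b) $ r \<le> snd q $ r"
      using q by (auto simp: C_def)
    define z where "z = u *\<^sub>R w + v *\<^sub>R w'"
    have v: "v = 1 - u"
      using uv by simp
    have "g \<bullet> (z - x) = u * (g \<bullet> (w - x)) + v * (g \<bullet> (w' - x))"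
      unfolding z_def v by (simp add: inner_simps algebra_simps)
    also have "\<dots> < u * fst p + v * fst q"
    proof (cases "u = 0")
      case False
      then show ?thesis
        using w(2) w'(2) uv by (intro add_less_le_mono mult_strict_left_mono mult_left_mono) auto
    qed (use w'(2) uv in simp)
    finally have 1: "g \<bullet> (z - x) < u * fst p + v * fst q" .
    have 2: "(A *v z - b) $ r \<le> u * snd p $ r + v * snd q $ r" for r
    proof -
      have "(A *v z - b) $ r = u * (A *v w - b) $ r + v * (A *v w' - b) $ r"
        unfolding z_def v by (simp add: matrix_vector_right_distrib matrix_vector_mult_scaleR algebra_simps)
      also have "\<dots> \<le> u * snd p $ r + v * snd q $ r"
        using w(3) w'(3) uv by (intro add_mono mult_left_mono) auto
      finally show ?thesis .
    qed
    have "z \<in> S"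
      unfolding z_def using S w(1) w'(1) uv by (rule convexD)
    then show "u *\<^sub>R p + v *\<^sub>R q \<in> C"
      using 1 2 by (auto simp: C_def case_prod_beta)
  qed
  moreover have "0 \<notin> C"
    using opt by (auto simp: C_def zero_prod_def not_less[symmetric] simp del: not_less)
  ultimately obtain h where h: "h \<noteq> 0" "\<And>p. p \<in> C \<Longrightarrow> 0 \<le> h \<bullet> p"
    using separating_hyperplane_set_0[of C] by auto
  define a where "a = fst h"
  define k where "k = snd h"
  have sep: "0 \<le> a * t + k \<bullet> s"
    if "w \<in> S" "g \<bullet> (w - x) < t" "\<And>r. (A *v w - b) $ r \<le> s $ r" for w t s
    using h(2)[of "(t, s)"] that by (auto simp: C_def a_def k_def inner_prod_def)
  have k: "0 \<le> k $ r" for r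
  proof (rule slope_nonneg)
    fix n :: real assume "n \<ge> 0"
    then have "0 \<le> a * 1 + k \<bullet> ((A *v x - b) + n *\<^sub>R axis r 1)"
      using x by (intro sep[of x]) (auto simp: axis_def)
    then show "0 \<le> (a + k \<bullet> (A *v x - b)) + n * k $ r"
      by (simp add: inner_simps inner_axis algebra_simps)
  qed
  have a: "0 \<le> a"
  proof (rule slope_nonneg)
    fix n :: real assume "n \<ge> 0"
    then have "0 \<le> a * (1 + n) + k \<bullet> (A *v x - b)"
      using x by (intro sep[of x]) auto
    then show "0 \<le> (a + k \<bullet> (A *v x - b)) + n * a"
      by (simp add: algebra_simps)
  qed
  have "a \<noteq> 0"
  proof
    assume a0: "a = 0"
    have "0 \<le> a * (g \<bullet> (x0 - x) + 1) + k \<bullet> (A *v x0 - b)"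
      using slater by (intro sep[of x0]) auto
    then have "0 \<le> (\<Sum>r\<in>UNIV. k $ r * (A *v x0 - b) $ r)"
      by (simp add: a0 inner_vec_def)
    moreover have "k \<noteq> 0"
      using h(1) a0 by (simp add: a_def k_def prod_eq_iff)
    then obtain r where "k $ r > 0"
      using k by (metis less_eq_real_def vec_eq_iff zero_index)
    have "0 < (\<Sum>r\<in>UNIV. - (k $ r * (A *v x0 - b) $ r))"
    proof (rule sum_pos2[of _ r])
      show "0 < - (k $ r * (A *v x0 - b) $ r)"
        using mult_pos_neg[OF \<open>k $ r > 0\<close> slater(2)] by simp
      show "0 \<le> - (k $ i * (A *v x0 - b) $ i)" for i
        using mult_nonneg_nonpos[OF k less_imp_le[OF slater(2)]] by simp
    qed auto
    ultimately show False
      by (simp add: sum_negf)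
  qed
  with a have a: "a > 0"
    by simp
  have main: "0 \<le> a * (g \<bullet> (w - x)) + k \<bullet> (A *v w - b)" if "w \<in> S" for w
  proof (rule field_le_epsilon)
    fix e :: real assume e: "0 < e"
    have "0 \<le> a * (g \<bullet> (w - x) + e / a) + k \<bullet> (A *v w - b)"
      using e a that by (intro sep[of w]) auto
    then show "0 \<le> a * (g \<bullet> (w - x)) + k \<bullet> (A *v w - b) + e"
      using a by (simp add: algebra_simps)
  qed
  have "k \<bullet> (A *v x - b) \<le> 0"
    unfolding inner_vec_def using k x(2) by (intro sum_nonpos) (simp add: mult_nonneg_nonpos)
  then have comp: "k \<bullet> (A *v x - b) = 0"
    using main[OF x(1)] by simp
  show ?thesis
  proof (rule that[of "k /\<^sub>R a"])
    show "0 \<le> (k /\<^sub>R a) $ r" for r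
      using k a by simp
    show "(k /\<^sub>R a) \<bullet> (A *v x - b) = 0"
      using comp by simp
    show "0 \<le> (g + transpose A *v (k /\<^sub>R a)) \<bullet> (w - x)" if "w \<in> S" for w
    proof -
      have "k \<bullet> (A *v w - b) = k \<bullet> (A *v (w - x))"
        using comp by (simp add: matrix_vector_mult_diff_distrib inner_simps)
      also have "\<dots> = (transpose A *v k) \<bullet> (w - x)"
        by (metis dot_lmul_matrix vector_transpose_matrix transpose_transpose)
      finally have "0 \<le> a * (g \<bullet> (w - x)) + (transpose A *v k) \<bullet> (w - x)"
        using main[OF that] by simp
      moreover have "a * ((g + transpose A *v (k /\<^sub>R a)) \<bullet> (w - x))
          = a * (g \<bullet> (w - x)) + (transpose A *v k) \<bullet> (w - x)"
        using a by (simp add: inner_add_left matrix_vector_mult_scaleR distrib_left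
            del: transpose_matrix_vector)
      ultimately show ?thesis
        using a by (metis zero_le_mult_iff not_less less_imp_le)
    qed
  qed
qed

text \<open>
  Both subgradient inequalities between \<open>v\<close> and \<open>w\<close> squeeze \<open>f w\<close> as \<open>w\<close> tends to \<open>v\<close>.
\<close>

lemma subgradient_selection_continuous:
  fixes f :: "'a::euclidean_space \<Rightarrow> real"
  assumes sub: "\<And>v w. f v + h v \<bullet> (w - v) \<le> f w" and cont: "continuous_on UNIV h"
  shows "continuous_on UNIV f"
proof -
  have "(f \<longlongrightarrow> f v) (at v)" for v
  proof (rule tendsto_sandwich)
    have h: "(h \<longlongrightarrow> h v) (at v)"
      using cont by (simp add: continuous_on_eq_continuous_at isCont_def)
    have "((\<lambda>w. f v + h v \<bullet> (w - v)) \<longlongrightarrow> f v + h v \<bullet> (v - v)) (at v)"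
      by (intro tendsto_intros)
    then show "((\<lambda>w. f v + h v \<bullet> (w - v)) \<longlongrightarrow> f v) (at v)"
      by simp
    have "((\<lambda>w. f v - h w \<bullet> (v - w)) \<longlongrightarrow> f v - h v \<bullet> (v - v)) (at v)"
      by (intro tendsto_intros h)
    then show "((\<lambda>w. f v - h w \<bullet> (v - w)) \<longlongrightarrow> f v) (at v)"
      by simp
    show "\<forall>\<^sub>F w in at v. f w \<le> f v - h w \<bullet> (v - w)"
      using sub[of _ v] by (intro always_eventually allI) (simp add: algebra_simps)
  qed (use sub in simp)
  then show ?thesis
    by (simp add: continuous_on_eq_continuous_at isCont_def)
qed

text \<open>
  Quadratic growth confines all competitors of a given point to a ball around it.
\<close>

lemma strongly_convex_attains_inf:
  fixes f :: "'a::euclidean_space \<Rightarrow> real"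
  assumes S: "closed S" "S \<noteq> {}" and c: "c > 0"
    and sub: "\<And>v w. f v + h v \<bullet> (w - v) + c * (norm (w - v))\<^sup>2 \<le> f w"
    and cont: "continuous_on UNIV h"
  obtains v where "v \<in> S" "\<And>w. w \<in> S \<Longrightarrow> f v \<le> f w"
proof -
  have "f v + h v \<bullet> (w - v) \<le> f w" for v w
    using sub[of v w] mult_nonneg_nonneg[OF less_imp_le[OF c] zero_le_power2[of "norm (w - v)"]] by linarith
  then have cont_f: "continuous_on UNIV f"
    using cont by (rule subgradient_selection_continuous)
  obtain v0 where v0: "v0 \<in> S"
    using S(2) by blast
  let ?K = "S \<inter> cball v0 (norm (h v0) / c)"
  have "compact ?K"
    using S(1) by (simp add: closed_Int_compact)
  moreover have "v0 \<in> ?K"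
    using v0 c by simp
  ultimately obtain v where v: "v \<in> ?K" "\<And>w. w \<in> ?K \<Longrightarrow> f v \<le> f w"
    using continuous_attains_inf[of ?K f] continuous_on_subset[OF cont_f] by blast
  show ?thesis
  proof (rule that)
    show "v \<in> S"
      using v(1) by simp
    show "f v \<le> f w" if "w \<in> S" for w
    proof (cases "w \<in> ?K")
      case False
      then have "norm (h v0) / c < norm (w - v0)"
        using that by (auto simp: dist_norm norm_minus_commute)
      then have "norm (h v0) \<le> c * norm (w - v0)"
        using c by (simp add: field_simps)
      then have "norm (h v0) * norm (w - v0) \<le> c * (norm (w - v0))\<^sup>2"
        unfolding power2_eq_square by (metis mult.assoc mult_right_mono norm_ge_zero)
      moreover have "- (norm (h v0) * norm (w - v0)) \<le> h v0 \<bullet> (w - v0)"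
        using Cauchy_Schwarz_ineq2[of "h v0" "w - v0"] by linarith
      ultimately have "f v0 \<le> f w"
        using sub[of v0 w] by linarith
      then show ?thesis
        using v(2)[OF \<open>v0 \<in> ?K\<close>] by linarith
    qed (rule v(2))
  qed
qed

text \<open>
  The subgradient at a nearby point of the segment from \<open>v\<close> to \<open>w\<close>, tested against \<open>v\<close>, cannot
  point downhill; continuity of the selection carries this back to \<open>v\<close>.
\<close>

lemma minimizer_variational_inequality:
  fixes f :: "'a::euclidean_space \<Rightarrow> real"
  assumes S: "convex S" and v: "v \<in> S" and min: "\<And>w. w \<in> S \<Longrightarrow> f v \<le> f w"
    and sub: "\<And>v w. f v + h v \<bullet> (w - v) \<le> f w" and cont: "continuous_on UNIV h"
    and w: "w \<in> S"
  shows "0 \<le> h v \<bullet> (w - v)"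
proof -
  let ?p = "\<lambda>t. v + t *\<^sub>R (w - v)"
  have "((\<lambda>t. h (?p t) \<bullet> (w - v)) \<longlongrightarrow> h (?p 0) \<bullet> (w - v)) (at_right 0)"
  proof (intro tendsto_intros isCont_tendsto_compose[where g = h])
    show "isCont h (?p 0)"
      using cont by (simp add: continuous_on_eq_continuous_at)
  qed
  moreover have "\<forall>\<^sub>F t in at_right 0. 0 \<le> h (?p t) \<bullet> (w - v)"
    using eventually_at_right_real[of 0 1]
  proof (rule eventually_mono)
    show "(0::real) < 1"
      by simp
    fix t :: real assume t: "t \<in> {0<..<1}"
    have "?p t = (1 - t) *\<^sub>R v + t *\<^sub>R w"
      by (simp add: algebra_simps)
    then have "?p t \<in> S"
      using convexD_alt[OF S v w, of t] t by simp
    then have "f v \<le> f (?p t)"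
      by (rule min)
    moreover have "f (?p t) - t * (h (?p t) \<bullet> (w - v)) \<le> f v"
      using sub[of "?p t" v] by simp
    ultimately have "0 \<le> t * (h (?p t) \<bullet> (w - v))"
      by linarith
    then show "0 \<le> h (?p t) \<bullet> (w - v)"
      using t by (simp add: zero_le_mult_iff)
  qed
  ultimately have "0 \<le> h (?p 0) \<bullet> (w - v)"
    by (intro tendsto_lowerbound[of _ _ "at_right (0::real)"]) auto
  then show ?thesis
    by simp
qed

section \<open>Blocks, partial gradients and best responses\<close>

lemma linear_blk: "linear (blk G i)"
  by (rule linearI) (auto simp: blk_def vec_eq_iff)

lemma continuous_on_blk [continuous_intros]:
  "continuous_on S f \<Longrightarrow> continuous_on S (\<lambda>x. blk G i (f x))"
  by (rule bounded_linear.continuous_on[OF linear_blk[unfolded linear_conv_bounded_linear]])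

lemma blk_idem [simp]: "blk G i (blk G i v) = blk G i v"
  by (simp add: blk_def vec_eq_iff)

lemma blk_other: "i \<noteq> j \<Longrightarrow> blk G j (blk G i v) = 0"
  by (simp add: blk_def vec_eq_iff)

lemma inner_blk: "blk G i u \<bullet> v = u \<bullet> blk G i v"
  by (auto simp: blk_def inner_vec_def intro!: sum.cong)

lemma sum_blk: "(\<Sum>i\<in>UNIV. blk G i v) = v"
  for G :: "('p::finite, 'c::finite, 'm::finite) game"
  by (simp add: vec_eq_iff blk_def)

lemma join_eq: "join G i v x = blk G i v + (x - blk G i x)"
  by (simp add: join_def blk_def vec_eq_iff)

lemma blk_join: "blk G j (join G i v x) = (if j = i then blk G i v else blk G j x)"
  by (auto simp: blk_def join_def vec_eq_iff)

lemma cblk_mult_blk: "cblk G i *v blk G i x = cblk G i *v x"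
  by (auto simp: cblk_def blk_def matrix_vector_mult_def vec_eq_iff intro!: sum.cong)

lemma sum_cblk_mult: "(\<Sum>i\<in>UNIV. cblk G i *v x) = cmat G *v x"
  for G :: "('p::finite, 'c::finite, 'm::finite) game"
proof -
  have "(\<Sum>i\<in>UNIV. (cblk G i *v x) $ r) = (cmat G *v x) $ r" for r
    unfolding matrix_vector_mult_def cblk_def
    by (simp, subst sum.swap) (simp add: if_distrib[of "\<lambda>u. u * _"] cong: if_cong)
  then show ?thesis
    by (simp add: vec_eq_iff)
qed

lemma transpose_cblk_mult: "transpose (cblk G i) *v l = blk G i (transpose (cmat G) *v l)"
  by (simp add: cblk_def blk_def matrix_vector_mult_def transpose_def vec_eq_iff)

lemma inner_transpose_mult: "(transpose A *v l) \<bullet> x = l \<bullet> (A *v x)"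
  for A :: "real^'c^'m"
  by (metis dot_lmul_matrix vector_transpose_matrix transpose_transpose)

text \<open>
  The cost as a function of the player's own block is constant in the other coordinates, so moving
  along the part of \<open>g\<close> outside the block costs nothing, which forces that part to vanish.
\<close>

lemma partial_subdiff_supported:
  assumes g: "g \<in> partial_subdiff G i x"
  shows "blk G i g = g"
proof -
  let ?d = "g - blk G i g"
  have "join G i (x + ?d) x = join G i x x"
    by (simp add: join_eq linear_add[OF linear_blk] linear_diff[OF linear_blk])
  moreover have sub: "\<bar>cost G i (join G i x x)\<bar> \<noteq> \<infinity> \<and>
      cost G i (join G i x x) + ereal (g \<bullet> (w - x)) \<le> cost G i (join G i w x)" for w
    using g unfolding partial_subdiff_def subdifferential_def by auto
  ultimately have "g \<bullet> ?d \<le> 0"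
    using sub[of "x + ?d"] by (cases "cost G i (join G i x x)") auto
  moreover have "blk G i g \<bullet> ?d = 0"
    by (simp add: inner_blk linear_diff[OF linear_blk])
  ultimately have "?d \<bullet> ?d \<le> 0"
    by (simp add: inner_diff_left)
  then have "?d = 0"
    by (metis inner_ge_zero inner_eq_zero_iff order_antisym)
  then show ?thesis
    by simp
qed

text \<open>
  Exchanging one block of the pseudogradient for another partial subgradient yields a second element
  of the pseudogradient, so uniqueness of the whole gives uniqueness of each block.
\<close>

lemma partial_subdiff_eq_gradient:
  assumes single: "\<And>x. pseudogradient G x = {F x}"
  shows "partial_subdiff G i x = {blk G i (F x)}"
proof
  have Fx: "blk G j (F x) \<in> partial_subdiff G j x" for j
    using single[of x] unfolding pseudogradient_def by blast
  then show "{blk G i (F x)} \<subseteq> partial_subdiff G i x"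
    by simp
  show "partial_subdiff G i x \<subseteq> {blk G i (F x)}"
  proof
    fix g assume g: "g \<in> partial_subdiff G i x"
    have "join G i g (F x) \<in> pseudogradient G x"
      unfolding pseudogradient_def using Fx g partial_subdiff_supported[OF g] by (auto simp: blk_join)
    then have "join G i g (F x) = F x"
      using single[of x] by simp
    then have "blk G i g = blk G i (F x)"
      by (metis blk_join)
    then show "g \<in> {blk G i (F x)}"
      using partial_subdiff_supported[OF g] by simp
  qed
qed

text \<open>
  The extended pseudogradient is blockwise the ordinary one at the private estimates, so continuity
  of the one gives continuity of all blocks of the other.
\<close>

lemma blk_ext_pseudogradient:
  assumes F: "\<And>x. pseudogradient G x = {F x}" and FF: "\<And>Y. ext_pseudogradient G Y = {FF Y}"
  shows "blk G i (FF Y) = blk G i (F (Y $ i))"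
proof -
  have "blk G i (FF Y) \<in> partial_subdiff G i (Y $ i)"
    using FF[of Y] unfolding ext_pseudogradient_def by blast
  then show ?thesis
    unfolding partial_subdiff_eq_gradient[OF F] by simp
qed

text \<open>
  A subgradient exists at every point, so the cost is finite everywhere and can be treated as a real
  function.
\<close>

lemma cost_subgradient:
  assumes F: "\<And>x. pseudogradient G x = {F x}"
  obtains f where "\<And>v. cost G i (join G i v x) = ereal (f v)"
    "\<And>v w. f v + blk G i (F (join G i v x)) \<bullet> (w - v) \<le> f w"
proof -
  have sub: "\<bar>cost G i (join G i v x)\<bar> \<noteq> \<infinity> \<and>
      cost G i (join G i v x) + ereal (blk G i (F (join G i v x)) \<bullet> (w - v)) \<le> cost G i (join G i w x)"
    for v w
  proof -
    let ?x = "join G i v x"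
    have join: "join G i ?x ?x = ?x" "join G i ?x x = ?x" "join G i u ?x = join G i u x" for u
      by (simp_all add: join_def vec_eq_iff)
    have "blk G i (F ?x) \<in> subdifferential (\<lambda>v. cost G i (join G i v ?x)) ?x"
      using partial_subdiff_eq_gradient[OF F, of i ?x] unfolding partial_subdiff_def by blast
    then have "\<bar>cost G i ?x\<bar> \<noteq> \<infinity> \<and>
        cost G i ?x + ereal (blk G i (F ?x) \<bullet> (w - ?x)) \<le> cost G i (join G i w x)"
      unfolding subdifferential_def join by auto
    moreover have "blk G i (F ?x) \<bullet> (w - ?x) = blk G i (F ?x) \<bullet> (w - v)"
      by (simp add: inner_blk linear_diff[OF linear_blk] blk_join)
    ultimately show ?thesis
      by simp
  qed
  define f where "f v = real_of_ereal (cost G i (join G i v x))" for v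
  have f: "cost G i (join G i v x) = ereal (f v)" for v
    using sub[of v] by (simp add: f_def ereal_real)
  show ?thesis
    by (rule that[of f]) (use sub f in auto)
qed

lemma arg_min_on_attained:
  fixes f :: "'a \<Rightarrow> 'b::linorder"
  assumes "v \<in> S" "\<And>w. w \<in> S \<Longrightarrow> f v \<le> f w"
  shows "arg_min_on f S \<in> S" "\<And>w. w \<in> S \<Longrightarrow> f (arg_min_on f S) \<le> f w"
proof -
  have "is_arg_min f (\<lambda>x. x \<in> S) v"
    using assms by (auto simp: is_arg_min_def not_less)
  then have "is_arg_min f (\<lambda>x. x \<in> S) (arg_min_on f S)"
    unfolding arg_min_on_def arg_min_def by (rule someI)
  then show "arg_min_on f S \<in> S" "\<And>w. w \<in> S \<Longrightarrow> f (arg_min_on f S) \<le> f w"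
    by (auto simp: is_arg_min_def not_less)
qed

text \<open>
  The proximal term makes the objective strongly convex, so a minimizer exists, and
  \<open>arg_min_on\<close> denotes one.  The gradient of the objective in the player's own block is continuous,
  which gives the first-order condition.
\<close>

lemma best_response_variational_inequality:
  assumes F: "\<And>x. pseudogradient G x = {F x}" and cont: "continuous_on UNIV F"
    and S: "closed S" "convex S" "S \<noteq> {}" and c: "c > 0"
    and obj: "\<And>v. obj v = cost G i (join G i v x) + ereal (u \<bullet> v + c * (norm (v - p))\<^sup>2)"
  defines "v \<equiv> arg_min_on obj S"
  shows "v \<in> S" "\<And>w. w \<in> S \<Longrightarrow> 0 \<le> (blk G i (F (join G i v x)) + u + (2 * c) *\<^sub>R (v - p)) \<bullet> (w - v)"
proof -
  obtain f where f: "\<And>v. cost G i (join G i v x) = ereal (f v)"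
    "\<And>v w. f v + blk G i (F (join G i v x)) \<bullet> (w - v) \<le> f w"
    using cost_subgradient[OF F] by blast
  define g where "g v = f v + (u \<bullet> v + c * (norm (v - p))\<^sup>2)" for v
  define h where "h v = blk G i (F (join G i v x)) + u + (2 * c) *\<^sub>R (v - p)" for v
  have obj_g: "obj v = ereal (g v)" for v
    by (simp add: obj f(1) g_def)
  have quad: "c * (norm (w - p))\<^sup>2
      = c * (norm (v - p))\<^sup>2 + (2 * c) *\<^sub>R (v - p) \<bullet> (w - v) + c * (norm (w - v))\<^sup>2" for v w
    by (simp add: power2_norm_eq_inner inner_simps inner_commute algebra_simps)
  have strong: "g v + h v \<bullet> (w - v) + c * (norm (w - v))\<^sup>2 \<le> g w" for v w
    using f(2)[of v w] quad[of w v] by (simp add: g_def h_def inner_add_left inner_diff_right)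
  then have sub: "g v + h v \<bullet> (w - v) \<le> g w" for v w
    using mult_nonneg_nonneg[OF less_imp_le[OF c] zero_le_power2[of "norm (w - v)"]] strong[of v w]
    by linarith
  have cont_h: "continuous_on UNIV h"
    unfolding h_def join_eq
    by (intro continuous_intros continuous_on_blk continuous_on_compose2[OF cont]) auto
  obtain v0 where "v0 \<in> S" "\<And>w. w \<in> S \<Longrightarrow> g v0 \<le> g w"
    using strongly_convex_attains_inf[OF S(1,3) c strong cont_h] by blast
  then have v: "v \<in> S" "\<And>w. w \<in> S \<Longrightarrow> g v \<le> g w"
    using arg_min_on_attained[of v0 S obj] unfolding v_def obj_g by auto
  then show "v \<in> S"
    by simp
  show "0 \<le> (blk G i (F (join G i v x)) + u + (2 * c) *\<^sub>R (v - p)) \<bullet> (w - v)" if "w \<in> S" for w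
    using minimizer_variational_inequality[OF S(2) v sub cont_h that] by (simp add: h_def)
qed

section \<open>The splitting of the network KKT system\<close>

type_synonym ('p, 'c, 'm) state =
  "((real^'c)^'p) \<times> ((real^'m)^'p) \<times> ((real^'c)^('p \<times> 'p)) \<times> ((real^'m)^('p \<times> 'p))"

definition stacked_constraint :: "('p::finite, 'c::finite, 'm::finite) game \<Rightarrow> (real^'c)^'p \<Rightarrow> (real^'m)^'p" where
  "stacked_constraint G y = (\<chi> i. cblk G i *v y $ i)"

definition stacked_constraint_adj :: "('p::finite, 'c::finite, 'm::finite) game \<Rightarrow> (real^'m)^'p \<Rightarrow> (real^'c)^'p" where
  "stacked_constraint_adj G l = (\<chi> i. transpose (cblk G i) *v l $ i)"

definition rescale :: "('i \<Rightarrow> real) \<Rightarrow> 'a::real_vector^'i \<Rightarrow> 'a^'i::finite" where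
  "rescale d x = (\<chi> i. d i *\<^sub>R x $ i)"

definition coupling ::
  "('p::finite, 'c::finite, 'm::finite) game \<Rightarrow> ('p \<times> 'p) set \<Rightarrow> ('p, 'm) params \<Rightarrow>
   ('p, 'c, 'm) state \<Rightarrow> ('p, 'c, 'm) state" where
  "coupling G E P = (\<lambda>(y, l, m, z).
     (stacked_constraint_adj G l + inflow E m + rho_mu P *\<^sub>R inflow E (edge_diff E y),
      - stacked_constraint G y + inflow E z + rho_z P *\<^sub>R inflow E (edge_diff E l),
      - edge_diff E y,
      - edge_diff E l))"

text \<open>
  The first row subtracts half of the first row of \<open>coupling\<close>, the second row half of the terms in
  \<open>z\<close> and \<open>l\<close>, and the other terms make the map symmetric.  In the resolvent of either half of the
  coupling, this cancels the implicit dependence of a row on blocks that are computed later.  Pairs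
  that are not edges get weight one so that the map stays definite on the full edge space.
\<close>

definition precond ::
  "('p::finite, 'c::finite, 'm::finite) game \<Rightarrow> ('p \<times> 'p) set \<Rightarrow> ('p, 'm) params \<Rightarrow>
   ('p, 'c, 'm) state \<Rightarrow> ('p, 'c, 'm) state" where
  "precond G E P = (\<lambda>(y, l, m, z).
     (rescale (\<lambda>i. inverse (tau1 P i)) y
        - (1/2) *\<^sub>R (stacked_constraint_adj G l + inflow E m + rho_mu P *\<^sub>R inflow E (edge_diff E y)),
      rescale (\<lambda>i. inverse (tau2 P i)) l
        - (1/2) *\<^sub>R (stacked_constraint G y + inflow E z + rho_z P *\<^sub>R inflow E (edge_diff E l)),
      rescale (\<lambda>e. if e \<in> E then inverse (tau3 P e) else 1) m - (1/2) *\<^sub>R edge_diff E y,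
      rescale (\<lambda>e. if e \<in> E then inverse (tau4 P e) else 1) z - (1/2) *\<^sub>R edge_diff E l))"

text \<open>
  The vector \<open>p\<close> collects the gradients of the costs plus normals of the local sets, supported on
  each player's own block; \<open>q\<close> collects the shares \<open>bvec P i\<close> plus normals of the orthant.
\<close>

definition game_relation ::
  "('p::finite, 'c::finite, 'm::finite) game \<Rightarrow> ('p, 'm) params \<Rightarrow> (real^'c \<Rightarrow> real^'c) \<Rightarrow>
   (('p, 'c, 'm) state \<times> ('p, 'c, 'm) state) set" where
  "game_relation G P F = {((y, l, m, z), (p, q, r, s)).
     (\<forall>i. blk G i (p $ i) = p $ i \<and> blk G i (y $ i) \<in> local_set G i \<and>
       (\<forall>w\<in>local_set G i. (p $ i - blk G i (F (y $ i))) \<bullet> (w - blk G i (y $ i)) \<le> 0)) \<and>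
     (\<forall>i. l $ i \<in> nonneg_orthant \<and>
       (\<forall>u\<in>nonneg_orthant. (q $ i - bvec P i) \<bullet> (u - l $ i) \<le> 0)) \<and>
     r = 0 \<and> s = 0}"

definition edge_mask :: "('p \<times> 'p) set \<Rightarrow> ('p \<times> 'p \<Rightarrow> 'a::real_vector) \<Rightarrow> 'a^('p \<times> 'p::finite)" where
  "edge_mask E f = (\<chi> e. if e \<in> E then f e else 0)"

text \<open>
  The iteration also changes the values at pairs that are not edges, by arbitrary factors; in the
  splitting such a component has to stand still, so it is reset to zero.
\<close>

definition encode ::
  "('p \<times> 'p) set \<Rightarrow> ('p::finite, 'c::finite, 'm::finite) iterate \<Rightarrow> ('p, 'c, 'm) state" where
  "encode E t = (yv t, lv t, edge_mask E (mv t), edge_mask E (zv t))"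

lemma linear_stacked_constraint: "linear (stacked_constraint G)"
  by (rule linearI) (simp_all add: stacked_constraint_def vec_eq_iff matrix_vector_right_distrib
      matrix_vector_mult_scaleR)

lemma linear_stacked_constraint_adj: "linear (stacked_constraint_adj G)"
  by (rule linearI) (simp_all add: stacked_constraint_adj_def vec_eq_iff matrix_vector_right_distrib
      matrix_vector_mult_scaleR del: transpose_matrix_vector)

lemma inner_stacked_constraint_adj: "y \<bullet> stacked_constraint_adj G l = l \<bullet> stacked_constraint G y"
  unfolding stacked_constraint_adj_def stacked_constraint_def inner_vec_def[of y] inner_vec_def[of l] vec_lambda_beta
  by (subst inner_commute) (simp only: inner_transpose_mult)

lemma inner_inflow_left: "inflow E m \<bullet> y = m \<bullet> edge_diff E y"
  by (metis inner_inflow inner_commute)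

lemma inner_stacked_constraint_adj_left: "stacked_constraint_adj G l \<bullet> y = l \<bullet> stacked_constraint G y"
  by (metis inner_stacked_constraint_adj inner_commute)

lemma linear_rescale: "linear (rescale d)"
  by (rule linearI) (simp_all add: rescale_def vec_eq_iff scaleR_add_right)

lemma inner_rescale: "x \<bullet> rescale d y = rescale d x \<bullet> y"
  by (simp add: rescale_def inner_vec_def[of x] inner_vec_def[of _ y])

lemma inner_rescale_self: "x \<bullet> rescale d x = (\<Sum>i\<in>UNIV. d i * (norm (x $ i))\<^sup>2)"
  for x :: "'a::real_inner^'i::finite"
  by (simp add: rescale_def inner_vec_def[of x] power2_norm_eq_inner)

lemma inner_rescale_pos:
  fixes x :: "'a::real_inner^'i::finite"
  assumes "\<And>i. 0 < d i"
  shows "0 \<le> x \<bullet> rescale d x" and "x \<noteq> 0 \<Longrightarrow> 0 < x \<bullet> rescale d x"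
proof -
  have nonneg: "0 \<le> d i * (norm (x $ i))\<^sup>2" for i
    using assms[of i] by simp
  then show "0 \<le> x \<bullet> rescale d x"
    unfolding inner_rescale_self by (intro sum_nonneg)
  assume "x \<noteq> 0"
  then obtain i where "x $ i \<noteq> 0"
    by (auto simp: vec_eq_iff)
  then show "0 < x \<bullet> rescale d x"
    unfolding inner_rescale_self using assms[of i] nonneg by (intro sum_pos2[of _ i]) auto
qed

lemmas block_linear_simps =
  linear_add[OF linear_stacked_constraint] linear_diff[OF linear_stacked_constraint] linear_cmul[OF linear_stacked_constraint]
  linear_add[OF linear_stacked_constraint_adj] linear_diff[OF linear_stacked_constraint_adj] linear_cmul[OF linear_stacked_constraint_adj]
  linear_add[OF linear_inflow] linear_diff[OF linear_inflow] linear_cmul[OF linear_inflow]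
  linear_add[OF linear_edge_diff] linear_diff[OF linear_edge_diff] linear_cmul[OF linear_edge_diff]
  linear_add[OF linear_rescale] linear_diff[OF linear_rescale] linear_cmul[OF linear_rescale]

lemma linear_coupling: "linear (coupling G E P)"
  by (rule linearI)
    (auto simp: coupling_def block_linear_simps algebra_simps split: prod.splits)

lemma linear_precond: "linear (precond G E P)"
  by (rule linearI)
    (auto simp: precond_def block_linear_simps algebra_simps split: prod.splits)

text \<open>
  The skew part drops out, and only the two Laplacian forms remain.
\<close>

lemma inner_coupling:
  "(y, l, m, z) \<bullet> coupling G E P (y, l, m, z)
     = rho_mu P * (norm (edge_diff E y))\<^sup>2 + rho_z P * (norm (edge_diff E l))\<^sup>2"
  by (simp add: coupling_def inner_add_right inner_diff_right inner_inflow inner_stacked_constraint_adj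
      inner_commute[of m] inner_commute[of z] power2_norm_eq_inner)

lemma precond_symmetric: "precond G E P x \<bullet> y = x \<bullet> precond G E P y"
proof -
  obtain x1 x2 x3 x4 where x: "x = (x1, x2, x3, x4)"
    by (cases x rule: prod_cases4)
  obtain y1 y2 y3 y4 where y: "y = (y1, y2, y3, y4)"
    by (cases y rule: prod_cases4)
  show ?thesis
    unfolding x y precond_def
    by (simp add: inner_add_left inner_add_right inner_diff_left inner_diff_right inner_rescale
        inner_inflow inner_stacked_constraint_adj inner_inflow_left inner_stacked_constraint_adj_left algebra_simps)
      (simp add: inner_commute)
qed

text \<open>
  Young's inequality for each matrix entry; summing over rows gives the column sums and conversely.
\<close>

lemma inner_matrix_le:
  fixes M :: "real^'c^'m"
  shows "l \<bullet> (M *v x) \<le> 1/2 * mat_norm1 M * (norm x)\<^sup>2 + 1/2 * mat_norm_inf M * (norm l)\<^sup>2"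
proof -
  have "l \<bullet> (M *v x) = (\<Sum>r\<in>UNIV. \<Sum>c\<in>UNIV. l $ r * (M $ r $ c * x $ c))"
    by (simp add: inner_vec_def matrix_vector_mult_def sum_distrib_left)
  also have "\<dots> \<le> (\<Sum>r\<in>UNIV. \<Sum>c\<in>UNIV. 1/2 * (\<bar>M $ r $ c\<bar> * (x $ c)\<^sup>2) + 1/2 * (\<bar>M $ r $ c\<bar> * (l $ r)\<^sup>2))"
  proof (intro sum_mono)
    fix r c
    have "l $ r * (M $ r $ c * x $ c) \<le> \<bar>M $ r $ c\<bar> * (\<bar>x $ c\<bar> * \<bar>l $ r\<bar>)"
      by (rule order_trans[OF abs_ge_self]) (simp add: abs_mult)
    also have "\<dots> \<le> \<bar>M $ r $ c\<bar> * (1/2 * (x $ c)\<^sup>2 + 1/2 * (l $ r)\<^sup>2)"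
      using sum_squares_bound[of "\<bar>x $ c\<bar>" "\<bar>l $ r\<bar>"] by (intro mult_left_mono) auto
    finally show "l $ r * (M $ r $ c * x $ c)
        \<le> 1/2 * (\<bar>M $ r $ c\<bar> * (x $ c)\<^sup>2) + 1/2 * (\<bar>M $ r $ c\<bar> * (l $ r)\<^sup>2)"
      by (simp add: algebra_simps)
  qed
  also have "\<dots> = 1/2 * (\<Sum>c\<in>UNIV. (\<Sum>r\<in>UNIV. \<bar>M $ r $ c\<bar>) * (x $ c)\<^sup>2)
      + 1/2 * (\<Sum>r\<in>UNIV. (\<Sum>c\<in>UNIV. \<bar>M $ r $ c\<bar>) * (l $ r)\<^sup>2)"
  proof -
    have "(\<Sum>r\<in>UNIV. \<Sum>c\<in>UNIV. \<bar>M $ r $ c\<bar> * (x $ c)\<^sup>2) = (\<Sum>c\<in>UNIV. \<Sum>r\<in>UNIV. \<bar>M $ r $ c\<bar> * (x $ c)\<^sup>2)"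
      by (rule sum.swap)
    then show ?thesis
      by (simp add: sum.distrib sum_distrib_right sum_divide_distrib[symmetric])
  qed
  also have "\<dots> \<le> 1/2 * (\<Sum>c\<in>UNIV. mat_norm1 M * (x $ c)\<^sup>2) + 1/2 * (\<Sum>r\<in>UNIV. mat_norm_inf M * (l $ r)\<^sup>2)"
    unfolding mat_norm1_def mat_norm_inf_def
    by (intro add_mono mult_left_mono sum_mono mult_right_mono Max_ge) auto
  also have "\<dots> = 1/2 * mat_norm1 M * (norm x)\<^sup>2 + 1/2 * mat_norm_inf M * (norm l)\<^sup>2"
    by (simp add: norm_sq_vec sum_distrib_left)
  finally show ?thesis .
qed

text \<open>
  Diagonal dominance.  An edge difference is bounded by the values at the two end points, which
  produces the degrees, and the constraint term by the two induced matrix norms; after splitting the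
  mixed terms evenly, each diagonal weight retains the positive slack in its step-size bound.
\<close>

lemma precond_positive_definite:
  fixes G :: "('p::finite, 'c::finite, 'm::finite) game"
  assumes irr: "irrefl E" and rho: "rho_mu P \<ge> 0" "rho_z P \<ge> 0"
    and tau1: "\<And>i. inverse (tau1 P i) >
      1/2 * mat_norm1 (cblk G i) + (1/2 + rho_mu P) * real (degree_of E i)"
    and tau2: "\<And>i. inverse (tau2 P i) >
      1/2 * mat_norm_inf (cblk G i) + (1/2 + rho_z P) * real (degree_of E i)"
    and tau3: "\<And>e. e \<in> E \<Longrightarrow> inverse (tau3 P e) > 1"
    and tau4: "\<And>e. e \<in> E \<Longrightarrow> inverse (tau4 P e) > 1"
    and x: "x \<noteq> 0"
  shows "0 < x \<bullet> precond G E P x"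
proof -
  obtain y l m z where xs: "x = (y, l, m, z)"
    by (cases x rule: prod_cases4)
  define d1 where "d1 i = inverse (tau1 P i)
    - (1/2 * mat_norm1 (cblk G i) + (1/2 + rho_mu P) * real (degree_of E i))" for i
  define d2 where "d2 i = inverse (tau2 P i)
    - (1/2 * mat_norm_inf (cblk G i) + (1/2 + rho_z P) * real (degree_of E i))" for i
  define d3 where "d3 e = (if e \<in> E then inverse (tau3 P e) - 1 else 1)" for e
  define d4 where "d4 e = (if e \<in> E then inverse (tau4 P e) - 1 else 1)" for e
  have pos: "\<And>i. 0 < d1 i" "\<And>i. 0 < d2 i" "\<And>e. 0 < d3 e" "\<And>e. 0 < d4 e"
    using tau1 tau2 tau3 tau4 by (auto simp: d1_def d2_def d3_def d4_def)
  let ?dy = "\<Sum>i\<in>UNIV. real (degree_of E i) * (norm (y $ i))\<^sup>2"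
  let ?dl = "\<Sum>i\<in>UNIV. real (degree_of E i) * (norm (l $ i))\<^sup>2"
  have ey: "rho_mu P * (norm (edge_diff E y))\<^sup>2 \<le> 2 * (rho_mu P * ?dy)"
    using mult_left_mono[OF norm_edge_diff_le[OF irr, of y] rho(1)] by simp
  have el: "rho_z P * (norm (edge_diff E l))\<^sup>2 \<le> 2 * (rho_z P * ?dl)"
    using mult_left_mono[OF norm_edge_diff_le[OF irr, of l] rho(2)] by simp
  have k: "l \<bullet> stacked_constraint G y \<le> 1/2 * (\<Sum>i\<in>UNIV. mat_norm1 (cblk G i) * (norm (y $ i))\<^sup>2)
      + 1/2 * (\<Sum>i\<in>UNIV. mat_norm_inf (cblk G i) * (norm (l $ i))\<^sup>2)"
  proof -
    have "l \<bullet> stacked_constraint G y = (\<Sum>i\<in>UNIV. l $ i \<bullet> (cblk G i *v y $ i))"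
      by (simp add: inner_vec_def[of l] stacked_constraint_def)
    also have "\<dots> \<le> (\<Sum>i\<in>UNIV. 1/2 * mat_norm1 (cblk G i) * (norm (y $ i))\<^sup>2
        + 1/2 * mat_norm_inf (cblk G i) * (norm (l $ i))\<^sup>2)"
      by (intro sum_mono inner_matrix_le)
    finally show ?thesis
      by (simp add: sum.distrib sum_divide_distrib)
  qed
  have w1: "y \<bullet> rescale (\<lambda>i. inverse (tau1 P i)) y = y \<bullet> rescale d1 y
      + (1/2 * (\<Sum>i\<in>UNIV. mat_norm1 (cblk G i) * (norm (y $ i))\<^sup>2) + 1/2 * ?dy + rho_mu P * ?dy)"
    unfolding inner_rescale_self d1_def sum_distrib_left sum.distrib[symmetric]
    by (rule sum.cong) (simp_all add: algebra_simps)
  have w2: "l \<bullet> rescale (\<lambda>i. inverse (tau2 P i)) l = l \<bullet> rescale d2 l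
      + (1/2 * (\<Sum>i\<in>UNIV. mat_norm_inf (cblk G i) * (norm (l $ i))\<^sup>2) + 1/2 * ?dl + rho_z P * ?dl)"
    unfolding inner_rescale_self d2_def sum_distrib_left sum.distrib[symmetric]
    by (rule sum.cong) (simp_all add: algebra_simps)
  have edges: "(\<Sum>e\<in>E. (norm (u $ e))\<^sup>2) = (\<Sum>e\<in>UNIV. if e \<in> E then (norm (u $ e))\<^sup>2 else 0)"
    for u :: "'a::real_inner^('p \<times> 'p)"
    by (rule sum.mono_neutral_cong_left) auto
  have w3: "m \<bullet> rescale (\<lambda>e. if e \<in> E then inverse (tau3 P e) else 1) m
      = m \<bullet> rescale d3 m + (\<Sum>e\<in>E. (norm (m $ e))\<^sup>2)"
    unfolding inner_rescale_self edges d3_def sum.distrib[symmetric]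
    by (rule sum.cong) (simp_all add: algebra_simps)
  have w4: "z \<bullet> rescale (\<lambda>e. if e \<in> E then inverse (tau4 P e) else 1) z
      = z \<bullet> rescale d4 z + (\<Sum>e\<in>E. (norm (z $ e))\<^sup>2)"
    unfolding inner_rescale_self edges d4_def sum.distrib[symmetric]
    by (rule sum.cong) (simp_all add: algebra_simps)
  have "x \<bullet> precond G E P x
      = y \<bullet> rescale (\<lambda>i. inverse (tau1 P i)) y + l \<bullet> rescale (\<lambda>i. inverse (tau2 P i)) l
        + m \<bullet> rescale (\<lambda>e. if e \<in> E then inverse (tau3 P e) else 1) m
        + z \<bullet> rescale (\<lambda>e. if e \<in> E then inverse (tau4 P e) else 1) z
        - l \<bullet> stacked_constraint G y - edge_diff E y \<bullet> m - edge_diff E l \<bullet> z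
        - 1/2 * (rho_mu P * (norm (edge_diff E y))\<^sup>2) - 1/2 * (rho_z P * (norm (edge_diff E l))\<^sup>2)"
    unfolding xs precond_def
    by (simp add: inner_add_right inner_diff_right inner_inflow inner_stacked_constraint_adj
        inner_commute[of m "edge_diff E y"] inner_commute[of z "edge_diff E l"] power2_norm_eq_inner
        add_divide_distrib)
  then have "y \<bullet> rescale d1 y + l \<bullet> rescale d2 l + m \<bullet> rescale d3 m + z \<bullet> rescale d4 z
      \<le> x \<bullet> precond G E P x"
    using w1 w2 w3 w4 k ey el inner_edge_diff_le[OF irr, of y m] inner_edge_diff_le[OF irr, of l z]
    by linarith
  moreover have "0 < y \<bullet> rescale d1 y + l \<bullet> rescale d2 l + m \<bullet> rescale d3 m + z \<bullet> rescale d4 z"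
  proof -
    note nonneg = inner_rescale_pos(1)[of d1 y, OF pos(1)] inner_rescale_pos(1)[of d2 l, OF pos(2)]
      inner_rescale_pos(1)[of d3 m, OF pos(3)] inner_rescale_pos(1)[of d4 z, OF pos(4)]
    consider "y \<noteq> 0" | "l \<noteq> 0" | "m \<noteq> 0" | "z \<noteq> 0"
      using x by (auto simp: xs zero_prod_def)
    then show ?thesis
    proof cases
      case 1
      then show ?thesis
        using inner_rescale_pos(2)[of d1 y, OF pos(1) 1] nonneg by linarith
    next
      case 2
      then show ?thesis
        using inner_rescale_pos(2)[of d2 l, OF pos(2) 2] nonneg by linarith
    next
      case 3
      then show ?thesis
        using inner_rescale_pos(2)[of d3 m, OF pos(3) 3] nonneg by linarith
    next
      case 4
      then show ?thesis
        using inner_rescale_pos(2)[of d4 z, OF pos(4) 4] nonneg by linarith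
    qed
  qed
  ultimately show ?thesis
    by linarith
qed

lemma closed_nonneg_orthant: "closed nonneg_orthant"
  unfolding nonneg_orthant_def by (intro closed_Collect_all closed_Collect_le continuous_intros)

lemma convex_nonneg_orthant: "convex nonneg_orthant"
  unfolding nonneg_orthant_def by (auto simp: convex_def)

lemma zero_in_nonneg_orthant: "0 \<in> nonneg_orthant"
  by (simp add: nonneg_orthant_def)

lemma closed_game_relation:
  assumes closed: "\<And>i. closed (local_set G i)" and cont: "continuous_on UNIV F"
  shows "closed (game_relation G P F)"
proof -
  have F: "continuous_on UNIV (\<lambda>x. F (f x))" if "continuous_on UNIV f"
    for f :: "'d::topological_space \<Rightarrow> _"
    by (rule continuous_on_compose2[OF cont that]) simp
  have mem: "closed {x. f x \<in> S}" if "closed S" "continuous_on UNIV f"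
    for f :: "'d::topological_space \<Rightarrow> 'e::topological_space" and S
    using closed_vimage[OF that] by (simp add: vimage_def)
  show ?thesis
    unfolding game_relation_def case_prod_beta Ball_def
    by (intro closed_Collect_conj closed_Collect_all closed_Collect_imp closed_Collect_eq
        closed_Collect_le open_Collect_const mem closed closed_nonneg_orthant F continuous_intros)
qed

section \<open>One round of the algorithm as a splitting step\<close>

lemma net_inflow_eq_inflow: "net_inflow E i f = inflow E (edge_mask E f) $ i"
  unfolding inflow_def net_inflow_eq_sum_edges edge_mask_def vec_lambda_beta
  by (rule sum.cong) auto

lemma edge_mask_diff:
  "edge_mask E (\<lambda>e. f e - c *\<^sub>R g e) = edge_mask E f - c *\<^sub>R edge_mask E g"
  by (simp add: edge_mask_def vec_eq_iff)

lemma nb_sum_eq_inflow: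
  "nb_sum E i (\<lambda>j. (a $ i - a $ j) - c *\<^sub>R (b $ i - b $ j)) = inflow E (edge_diff E (a - c *\<^sub>R b)) $ i"
  unfolding inflow_edge_diff by (rule arg_cong[of _ _ "nb_sum E i"]) (simp add: fun_eq_iff algebra_simps)

lemma blk_nb_sum: "nb_sum E i (\<lambda>j. blk G i (f j)) = blk G i (nb_sum E i f)"
  by (simp add: nb_sum_def linear_sum[OF linear_blk] linear_add[OF linear_blk])

lemma blk_stacked_constraint_adj: "blk G i (stacked_constraint_adj G l $ i) = stacked_constraint_adj G l $ i"
  by (simp add: stacked_constraint_adj_def transpose_cblk_mult del: transpose_matrix_vector)

text \<open>
  The rows show the triangular structure of the first resolvent: a new value enters a row only through
  the diagonal weights and through blocks that come earlier in the order \<open>y\<close>, \<open>l\<close>, \<open>m\<close>, \<open>z\<close>.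
\<close>

lemma precond_minus_half_coupling:
  "precond G E P ((y0, l0, m0, z0) - (y, l, m, z)) - (1/2) *\<^sub>R coupling G E P (y, l, m, z) =
     (rescale (\<lambda>i. inverse (tau1 P i)) (y0 - y)
        - (1/2) *\<^sub>R (stacked_constraint_adj G l0 + inflow E m0 + rho_mu P *\<^sub>R inflow E (edge_diff E y0)),
      rescale (\<lambda>i. inverse (tau2 P i)) (l0 - l) + stacked_constraint G (y - (1/2) *\<^sub>R y0)
        - (1/2) *\<^sub>R (inflow E z0 + rho_z P *\<^sub>R inflow E (edge_diff E l0)),
      rescale (\<lambda>e. if e \<in> E then inverse (tau3 P e) else 1) (m0 - m)
        + edge_diff E (y - (1/2) *\<^sub>R y0),
      rescale (\<lambda>e. if e \<in> E then inverse (tau4 P e) else 1) (z0 - z)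
        + edge_diff E (l - (1/2) *\<^sub>R l0))"
  unfolding precond_def coupling_def
  by (simp add: block_linear_simps vec_eq_iff) (simp add: field_simps)

text \<open>
  The same triangular structure for the second resolvent, in the form in which the updates are given.
\<close>

lemma precond_eq_half_coupling:
  assumes
    "rescale (\<lambda>i. inverse (tau1 P i)) (y - y')
       = stacked_constraint_adj G (l - (1/2) *\<^sub>R l0) + rho_mu P *\<^sub>R inflow E (edge_diff E (y - (1/2) *\<^sub>R y0))
         + inflow E (m - (1/2) *\<^sub>R m0)"
    "rescale (\<lambda>i. inverse (tau2 P i)) (l - l')
       = - stacked_constraint G (y' - (1/2) *\<^sub>R y0) + rho_z P *\<^sub>R inflow E (edge_diff E (l - (1/2) *\<^sub>R l0))
         + inflow E (z - (1/2) *\<^sub>R z0)"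
    "rescale (\<lambda>e. if e \<in> E then inverse (tau3 P e) else 1) (m - m') = - edge_diff E (y' - (1/2) *\<^sub>R y0)"
    "rescale (\<lambda>e. if e \<in> E then inverse (tau4 P e) else 1) (z - z') = - edge_diff E (l' - (1/2) *\<^sub>R l0)"
  shows "precond G E P ((y, l, m, z) - (y', l', m', z'))
    = (1/2) *\<^sub>R coupling G E P ((y, l, m, z) + (y', l', m', z') - (y0, l0, m0, z0))"
  unfolding precond_def coupling_def diff_Pair add_Pair case_prod_conv assms
  by (simp add: block_linear_simps vec_eq_iff) (simp add: field_simps)

lemma tilde_step_equation:
  assumes tau: "\<And>i. tau1 P i > 0" "\<And>i. tau2 P i > 0"
    "\<And>e. e \<in> E \<Longrightarrow> tau3 P e > 0" "\<And>e. e \<in> E \<Longrightarrow> tau4 P e > 0"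
  shows "precond G E P (encode E (main_step G E P t) - encode E (tilde_step G E P t))
    = (1/2) *\<^sub>R coupling G E P
        (encode E (main_step G E P t) + encode E (tilde_step G E P t) - encode E t)"
proof -
  define s where "s = main_step G E P t"
  define t' where "t' = tilde_step G E P t"
  have y: "yv t' $ i = yv s $ i - tau1 P i *\<^sub>R
      (stacked_constraint_adj G (lv s - (1/2) *\<^sub>R lv t)
        + rho_mu P *\<^sub>R inflow E (edge_diff E (yv s - (1/2) *\<^sub>R yv t))
        + inflow E (edge_mask E (mv s) - (1/2) *\<^sub>R edge_mask E (mv t))) $ i" for i
    unfolding t'_def tilde_step_def Let_def s_def[symmetric]
    by (simp add: nb_sum_eq_inflow net_inflow_eq_inflow edge_mask_diff stacked_constraint_adj_def transpose_cblk_mult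
        del: transpose_matrix_vector)
  have l: "lv t' $ i = lv s $ i + tau2 P i *\<^sub>R
      (stacked_constraint G (yv t' - (1/2) *\<^sub>R yv t)
        - rho_z P *\<^sub>R inflow E (edge_diff E (lv s - (1/2) *\<^sub>R lv t))
        - inflow E (edge_mask E (zv s) - (1/2) *\<^sub>R edge_mask E (zv t))) $ i" for i
    unfolding t'_def tilde_step_def Let_def s_def[symmetric]
    by (simp add: nb_sum_eq_inflow net_inflow_eq_inflow edge_mask_diff stacked_constraint_def cblk_mult_blk)
  have m: "mv t' e = mv s e + tau3 P e *\<^sub>R edge_diff E (yv t' - (1/2) *\<^sub>R yv t) $ e" if "e \<in> E" for e
    unfolding t'_def tilde_step_def Let_def s_def[symmetric] using that
    by (cases e) (simp add: edge_diff_def algebra_simps)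
  have z: "zv t' e = zv s e + tau4 P e *\<^sub>R edge_diff E (lv t' - (1/2) *\<^sub>R lv t) $ e" if "e \<in> E" for e
    unfolding t'_def tilde_step_def Let_def s_def[symmetric] using that
    by (cases e) (simp add: edge_diff_def algebra_simps)
  have inv: "inverse (tau1 P i) * tau1 P i = 1" "inverse (tau2 P i) * tau2 P i = 1" for i
    using tau(1,2)[of i] by simp_all
  have "tau3 P e \<noteq> 0" "tau4 P e \<noteq> 0" if "e \<in> E" for e
    using tau(3,4)[OF that] by simp_all
  then show ?thesis
    unfolding s_def[symmetric] t'_def[symmetric] encode_def
    by (intro precond_eq_half_coupling)
      (simp_all add: vec_eq_iff rescale_def y l m z inv edge_mask_def, simp_all add: edge_diff_def)
qed

text \<open>
  Outside the own block the update makes \<open>p\<close> vanish, and on the own block the first-order condition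
  of the best response is the normal cone condition for \<open>p\<close>.
\<close>

lemma main_step_y_block:
  fixes G :: "('p::finite, 'c::finite, 'm::finite) game" and E :: "('p \<times> 'p) set"
    and P :: "('p, 'm) params" and t :: "('p, 'c, 'm) iterate"
  assumes F: "\<And>x. pseudogradient G x = {F x}" and cont: "continuous_on UNIV F"
    and local: "local_set G i \<subseteq> {v. blk G i v = v}" "closed (local_set G i)"
      "convex (local_set G i)" "local_set G i \<noteq> {}"
    and tau: "tau1 P i > 0"
  defines "s \<equiv> main_step G E P t"
  defines "p \<equiv> rescale (\<lambda>i. inverse (tau1 P i)) (yv t - yv s)
        - (1/2) *\<^sub>R (stacked_constraint_adj G (lv t) + inflow E (edge_mask E (mv t))
            + rho_mu P *\<^sub>R inflow E (edge_diff E (yv t)))"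
  shows "blk G i (yv s $ i) \<in> local_set G i"
    and "blk G i (p $ i) = p $ i"
    and "\<And>w. w \<in> local_set G i \<Longrightarrow> (p $ i - blk G i (F (yv s $ i))) \<bullet> (w - blk G i (yv s $ i)) \<le> 0"
proof -
  define N where "N = rho_mu P *\<^sub>R inflow E (edge_diff E (yv t)) + inflow E (edge_mask E (mv t))"
  define x where "x = y_explicit E P t i"
  define u where "u = (1/2) *\<^sub>R (stacked_constraint_adj G (lv t) $ i + blk G i (N $ i))"
  define v where "v = arg_min_on (y_objective G E P t i) (local_set G i)"
  have x: "x = yv t $ i - (tau1 P i / 2) *\<^sub>R (N $ i)"
    by (simp add: x_def y_explicit_def N_def net_inflow_eq_inflow
        inflow_edge_diff[symmetric] algebra_simps)
  have obj: "y_objective G E P t i w = cost G i (join G i w x)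
      + ereal (u \<bullet> w + 1 / (2 * tau1 P i) * (norm (w - blk G i (yv t $ i)))\<^sup>2)" for w
    by (simp add: y_objective_def x_def[symmetric] u_def N_def stacked_constraint_adj_def net_inflow_eq_inflow
        blk_nb_sum inflow_edge_diff inner_transpose_mult linear_add[OF linear_blk] linear_cmul[OF linear_blk]
        inner_add_left algebra_simps del: transpose_matrix_vector)
  have v: "v \<in> local_set G i"
    "\<And>w. w \<in> local_set G i \<Longrightarrow>
      0 \<le> (blk G i (F (join G i v x)) + u + (2 * (1 / (2 * tau1 P i))) *\<^sub>R (v - blk G i (yv t $ i))) \<bullet> (w - v)"
    unfolding v_def
    using best_response_variational_inequality[OF F cont local(2-4) _ obj] tau by simp_all
  have ys: "yv s $ i = join G i v x"
    by (simp add: s_def main_step_def Let_def v_def x_def)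
  have bv: "blk G i v = v"
    using v(1) local(1) by blast
  have blk_ys: "blk G i (yv s $ i) = v"
    unfolding ys by (simp add: blk_join bv)
  show "blk G i (yv s $ i) \<in> local_set G i"
    unfolding blk_ys by (rule v(1))
  have pi: "p $ i = inverse (tau1 P i) *\<^sub>R (yv t $ i - yv s $ i) - (1/2) *\<^sub>R (stacked_constraint_adj G (lv t) $ i + N $ i)"
    by (simp add: p_def rescale_def N_def algebra_simps)
  have inv: "tau1 P i * inverse (tau1 P i) = 1"
    using tau by simp
  have p: "p $ i = inverse (tau1 P i) *\<^sub>R (blk G i (yv t $ i) - v) - u"
    unfolding pi ys join_eq x bv u_def
    by (simp add: inv linear_diff[OF linear_blk] linear_cmul[OF linear_blk] algebra_simps)
  show "blk G i (p $ i) = p $ i"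
    unfolding p u_def
    by (simp add: linear_diff[OF linear_blk] linear_add[OF linear_blk] linear_cmul[OF linear_blk] bv
        blk_stacked_constraint_adj)
  show "(p $ i - blk G i (F (yv s $ i))) \<bullet> (w - blk G i (yv s $ i)) \<le> 0" if "w \<in> local_set G i" for w
  proof -
    have c: "2 * (1 / (2 * tau1 P i)) = inverse (tau1 P i)"
      using tau by (simp add: field_simps)
    have "p $ i - blk G i (F (yv s $ i))
        = - (blk G i (F (join G i v x)) + u + (2 * (1 / (2 * tau1 P i))) *\<^sub>R (v - blk G i (yv t $ i)))"
      unfolding p ys c by (simp add: algebra_simps)
    then show ?thesis
      unfolding blk_ys using v(2)[OF that] by (simp only: inner_minus_left)
  qed
qed

text \<open>
  The projection onto the orthant is characterized by its variational inequality; dividing by the step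
  size gives the normal cone condition for \<open>q\<close>.
\<close>

lemma main_step_l_block:
  fixes G :: "('p::finite, 'c::finite, 'm::finite) game" and E :: "('p \<times> 'p) set"
    and P :: "('p, 'm) params" and t :: "('p, 'c, 'm) iterate"
  assumes tau: "tau2 P i > 0"
  defines "s \<equiv> main_step G E P t"
  defines "q \<equiv> rescale (\<lambda>i. inverse (tau2 P i)) (lv t - lv s) + stacked_constraint G (yv s - (1/2) *\<^sub>R yv t)
        - (1/2) *\<^sub>R (inflow E (edge_mask E (zv t)) + rho_z P *\<^sub>R inflow E (edge_diff E (lv t)))"
  shows "lv s $ i \<in> nonneg_orthant"
    and "\<And>u. u \<in> nonneg_orthant \<Longrightarrow> (q $ i - bvec P i) \<bullet> (u - lv s $ i) \<le> 0"
proof -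
  define r where "r = lv t $ i + tau2 P i *\<^sub>R
      (stacked_constraint G (yv s - (1/2) *\<^sub>R yv t) $ i
        - (1/2) *\<^sub>R (inflow E (edge_mask E (zv t)) + rho_z P *\<^sub>R inflow E (edge_diff E (lv t))) $ i
        - bvec P i)"
  have ls: "lv s $ i = closest_point nonneg_orthant r"
  proof -
    have "lv s $ i = closest_point nonneg_orthant
        (lv t $ i + tau2 P i *\<^sub>R
          (cblk G i *v blk G i (yv s $ i) - (1/2) *\<^sub>R (cblk G i *v blk G i (yv t $ i))
            - (rho_z P / 2) *\<^sub>R nb_sum E i (\<lambda>j. lv t $ i - lv t $ j)
            - (1/2) *\<^sub>R net_inflow E i (zv t) - bvec P i))"
      unfolding s_def main_step_def Let_def by simp
    also have "\<dots> = closest_point nonneg_orthant r"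
      unfolding r_def
      by (rule arg_cong[of _ _ "closest_point nonneg_orthant"])
        (simp add: net_inflow_eq_inflow inflow_edge_diff[symmetric] cblk_mult_blk stacked_constraint_def
          matrix_vector_mult_diff_distrib matrix_vector_mult_scaleR algebra_simps)
    finally show ?thesis .
  qed
  have ne: "nonneg_orthant \<noteq> {}"
    using zero_in_nonneg_orthant by blast
  show "lv s $ i \<in> nonneg_orthant"
    unfolding ls by (rule closest_point_in_set[OF closed_nonneg_orthant ne])
  show "(q $ i - bvec P i) \<bullet> (u - lv s $ i) \<le> 0" if "u \<in> nonneg_orthant" for u
  proof -
    have "tau2 P i *\<^sub>R (q $ i - bvec P i) = r - lv s $ i"
      using tau by (simp add: q_def r_def rescale_def algebra_simps)
    then have "tau2 P i * ((q $ i - bvec P i) \<bullet> (u - lv s $ i)) \<le> 0"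
      using closest_point_dot[OF convex_nonneg_orthant closed_nonneg_orthant that, of r]
      unfolding ls by (metis inner_scaleR_left)
    then show ?thesis
      using tau by (simp add: mult_le_0_iff)
  qed
qed

lemma main_step_inclusion:
  fixes G :: "('p::finite, 'c::finite, 'm::finite) game" and E :: "('p \<times> 'p) set"
    and P :: "('p, 'm) params" and t :: "('p, 'c, 'm) iterate"
  assumes F: "\<And>x. pseudogradient G x = {F x}" and cont: "continuous_on UNIV F"
    and local: "\<And>i. local_set G i \<subseteq> {v. blk G i v = v}" "\<And>i. closed (local_set G i)"
      "\<And>i. convex (local_set G i)" "\<And>i. local_set G i \<noteq> {}"
    and tau: "\<And>i. tau1 P i > 0" "\<And>i. tau2 P i > 0"
    "\<And>e. e \<in> E \<Longrightarrow> tau3 P e > 0" "\<And>e. e \<in> E \<Longrightarrow> tau4 P e > 0"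
  defines "s \<equiv> main_step G E P t"
  shows "(encode E s, precond G E P (encode E t - encode E s) - (1/2) *\<^sub>R coupling G E P (encode E s))
    \<in> game_relation G P F"
proof -
  have m: "mv s e = mv t e + tau3 P e *\<^sub>R edge_diff E (yv s - (1/2) *\<^sub>R yv t) $ e" if "e \<in> E" for e
    unfolding s_def main_step_def Let_def using that
    by (cases e) (simp add: edge_diff_def algebra_simps)
  have z: "zv s e = zv t e + tau4 P e *\<^sub>R edge_diff E (lv s - (1/2) *\<^sub>R lv t) $ e" if "e \<in> E" for e
    unfolding s_def main_step_def Let_def using that
    by (cases e) (simp add: edge_diff_def algebra_simps)
  have "tau3 P e \<noteq> 0" "tau4 P e \<noteq> 0" if "e \<in> E" for e
    using tau(3,4)[OF that] by simp_all
  then have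
    "rescale (\<lambda>e. if e \<in> E then inverse (tau3 P e) else 1) (edge_mask E (mv t) - edge_mask E (mv s))
      + edge_diff E (yv s - (1/2) *\<^sub>R yv t) = 0"
    "rescale (\<lambda>e. if e \<in> E then inverse (tau4 P e) else 1) (edge_mask E (zv t) - edge_mask E (zv s))
      + edge_diff E (lv s - (1/2) *\<^sub>R lv t) = 0"
    by (simp_all add: vec_eq_iff rescale_def edge_mask_def m z, simp_all add: edge_diff_def)
  then show ?thesis
    unfolding encode_def precond_minus_half_coupling game_relation_def
    using main_step_y_block[OF F cont local tau(1), where E = E and t = t, folded s_def]
      main_step_l_block[where P = P and G = G and E = E and t = t, OF tau(2), folded s_def]
    by simp
qed

section \<open>Restricted monotonicity and zeros of the splitting\<close>

text \<open>
  Reading off every player's own block from the private copies is a contraction, as different blocks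
  are orthogonal.
\<close>

lemma norm_sum_blk_le: "norm (\<Sum>i\<in>UNIV. blk G i (u $ i)) \<le> norm u"
  for G :: "('p::finite, 'c::finite, 'm::finite) game"
proof (rule power2_le_imp_le)
  let ?R = "\<Sum>i\<in>UNIV. blk G i (u $ i)"
  have "?R \<bullet> ?R = (\<Sum>i\<in>UNIV. blk G i (u $ i) \<bullet> ?R)"
    by (rule inner_sum_left)
  also have "\<dots> = (\<Sum>i\<in>UNIV. blk G i (u $ i) \<bullet> blk G i (u $ i))"
  proof (rule sum.cong)
    fix i
    have "blk G i ?R = (\<Sum>j\<in>UNIV. if j = i then blk G i (u $ i) else 0)"
      unfolding linear_sum[OF linear_blk] by (rule sum.cong) (auto simp: blk_other)
    then have "blk G i ?R = blk G i (u $ i)"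
      by simp
    then show "blk G i (u $ i) \<bullet> ?R = blk G i (u $ i) \<bullet> blk G i (u $ i)"
      using inner_blk[of G i "blk G i (u $ i)" ?R] by simp
  qed simp
  also have "\<dots> \<le> (\<Sum>i\<in>UNIV. u $ i \<bullet> u $ i)"
  proof (rule sum_mono)
    fix i
    have "blk G i (u $ i) \<bullet> blk G i (u $ i) = (\<Sum>c\<in>UNIV. (blk G i (u $ i) $ c)\<^sup>2)"
      by (simp add: inner_vec_def power2_eq_square)
    also have "\<dots> \<le> (\<Sum>c\<in>UNIV. (u $ i $ c)\<^sup>2)"
      by (rule sum_mono) (simp add: blk_def)
    finally show "blk G i (u $ i) \<bullet> blk G i (u $ i) \<le> u $ i \<bullet> u $ i"
      by (simp add: inner_vec_def power2_eq_square)
  qed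
  finally show "(norm ?R)\<^sup>2 \<le> (norm u)\<^sup>2"
    by (simp add: power2_norm_eq_inner inner_vec_def[of u])
qed simp

text \<open>
  Split \<open>y\<close> into the average \<open>xb\<close> of the copies and the disagreement \<open>u\<close>.  Strong monotonicity at
  \<open>xb\<close> yields \<open>\<eta> a\<^sup>2\<close> with \<open>a\<close> the distance from \<open>xb\<close> to \<open>x\<close>, the Lipschitz bounds cost at
  most \<open>(\<theta>1 + \<theta>2) a b + \<theta>2 b\<^sup>2\<close> with \<open>b\<close> the norm of \<open>u\<close>, and the Laplacian term gives
  back a multiple of \<open>b\<^sup>2\<close> for which the quadratic form in \<open>a\<close> and \<open>b\<close> is nonnegative.
\<close>

lemma extended_pseudogradient_restricted_monotone:
  fixes G :: "('p::finite, 'c::finite, 'm::finite) game" and E :: "('p \<times> 'p) set"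
  assumes F: "\<And>x. pseudogradient G x = {F x}" and FF: "\<And>Y. ext_pseudogradient G Y = {FF Y}"
    and pos: "\<eta> > 0" "\<theta>1 > 0" "\<theta>2 > 0"
    and mono: "\<And>x x'. (x - x') \<bullet> (F x - F x') \<ge> \<eta> * (norm (x - x'))\<^sup>2"
    and lip1: "\<And>x x'. norm (F x - F x') \<le> \<theta>1 * norm (x - x')"
    and lip2: "\<And>Y Y'. norm (FF Y - FF Y') \<le> \<theta>2 * norm (Y - Y')"
    and irr: "irrefl E" and conn: "weakly_connected E"
    and rho: "\<rho> \<ge> 2 / second_smallest_eigenvalue (laplacian E) * ((\<theta>1 + \<theta>2)\<^sup>2 / (4 * \<eta>) + \<theta>2)"
      "\<rho> \<ge> 0"
  shows "0 \<le> (\<Sum>i\<in>UNIV. blk G i (y $ i - x) \<bullet> (blk G i (F (y $ i)) - blk G i (F x)))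
    + \<rho> / 2 * (norm (edge_diff E y))\<^sup>2"
proof -
  define xb where "xb = (1 / real CARD('p)) *\<^sub>R (\<Sum>i\<in>UNIV. y $ i)"
  define u where "u = y - (\<chi> i. xb)"
  define R where "R = (\<Sum>i\<in>UNIV. blk G i (u $ i))"
  define a where "a = norm (xb - x)"
  define b where "b = norm u"
  have const: "FF (\<chi> i. v) = F v" for v
  proof -
    have "FF (\<chi> i. v) = (\<Sum>i\<in>UNIV. blk G i (FF (\<chi> i. v)))"
      by (rule sum_blk[symmetric])
    also have "\<dots> = F v"
      by (simp add: blk_ext_pseudogradient[OF F FF] sum_blk)
    finally show ?thesis .
  qed
  have u0: "(\<Sum>i\<in>UNIV. u $ i) = 0"
    by (simp add: u_def xb_def sum_subtractf sum_constant_scaleR del: sum_constant)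
  have R: "norm R \<le> b"
    unfolding R_def b_def by (rule norm_sum_blk_le)
  have Ry: "(\<Sum>i\<in>UNIV. blk G i (y $ i - x)) = (xb - x) + R"
  proof -
    have "blk G i (y $ i - x) = blk G i (u $ i) + blk G i (xb - x)" for i
      by (simp add: u_def linear_diff[OF linear_blk])
    then show ?thesis
      by (simp add: R_def sum.distrib sum_blk)
  qed
  have split: "(\<Sum>i\<in>UNIV. blk G i (y $ i - x) \<bullet> (blk G i (F (y $ i)) - blk G i (F x)))
      = (xb - x + R) \<bullet> (FF y - F x)"
  proof -
    have "blk G i (y $ i - x) \<bullet> (blk G i (F (y $ i)) - blk G i (F x)) = blk G i (y $ i - x) \<bullet> (FF y - F x)" for i
      using inner_blk[of G i "y $ i - x" "FF y - F x"]
      by (simp add: blk_ext_pseudogradient[OF F FF, symmetric] linear_diff[OF linear_blk, symmetric]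
          inner_blk[symmetric])
    then show ?thesis
      unfolding Ry[symmetric] by (simp add: inner_sum_left)
  qed
  have "norm (FF y - F xb) \<le> \<theta>2 * b"
    using lip2[of y "\<chi> i. xb"] by (simp add: const b_def u_def)
  then have bounds: "norm (xb - x) * norm (FF y - F xb) \<le> a * (\<theta>2 * b)"
    "norm R * norm (F xb - F x) \<le> b * (\<theta>1 * a)"
    "norm R * norm (FF y - F xb) \<le> b * (\<theta>2 * b)"
    using R lip1[of xb x] pos by (auto simp: a_def b_def intro!: mult_mono)
  have "(xb - x + R) \<bullet> (FF y - F x) = (xb - x) \<bullet> (F xb - F x) + (xb - x) \<bullet> (FF y - F xb)
      + R \<bullet> (F xb - F x) + R \<bullet> (FF y - F xb)"
    by (simp add: inner_simps)
  moreover have "\<bar>(xb - x) \<bullet> (FF y - F xb)\<bar> \<le> norm (xb - x) * norm (FF y - F xb)"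
    "\<bar>R \<bullet> (F xb - F x)\<bar> \<le> norm R * norm (F xb - F x)"
    "\<bar>R \<bullet> (FF y - F xb)\<bar> \<le> norm R * norm (FF y - F xb)"
    by (rule Cauchy_Schwarz_ineq2)+
  moreover have "\<eta> * a\<^sup>2 \<le> (xb - x) \<bullet> (F xb - F x)"
    unfolding a_def by (rule mono)
  ultimately have low: "\<eta> * a\<^sup>2 - a * (\<theta>2 * b) - b * (\<theta>1 * a) - b * (\<theta>2 * b)
      \<le> (xb - x + R) \<bullet> (FF y - F x)"
    using bounds by linarith
  have quad: "((\<theta>1 + \<theta>2)\<^sup>2 / (4 * \<eta>) + \<theta>2) * b\<^sup>2 \<le> \<rho> / 2 * (norm (edge_diff E y))\<^sup>2"
  proof (cases "CARD('p) > 1")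
    case True
    let ?s = "second_smallest_eigenvalue (laplacian E)"
    have s: "0 < ?s"
      by (rule second_smallest_eigenvalue_laplacian(1)[OF irr conn True])
    have "?s * b\<^sup>2 \<le> (norm (edge_diff E u))\<^sup>2"
      unfolding b_def by (rule algebraic_connectivity_vector[OF irr conn True u0])
    also have "edge_diff E u = edge_diff E y"
      by (simp add: u_def linear_diff[OF linear_edge_diff])
    finally have "\<rho> / 2 * (?s * b\<^sup>2) \<le> \<rho> / 2 * (norm (edge_diff E y))\<^sup>2"
      using rho(2) by (intro mult_left_mono) auto
    moreover have "(\<theta>1 + \<theta>2)\<^sup>2 / (4 * \<eta>) + \<theta>2 \<le> \<rho> / 2 * ?s"
      using rho(1) s by (simp add: field_simps)
    then have "((\<theta>1 + \<theta>2)\<^sup>2 / (4 * \<eta>) + \<theta>2) * b\<^sup>2 \<le> \<rho> / 2 * ?s * b\<^sup>2"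
      by (rule mult_right_mono) simp
    ultimately show ?thesis
      by simp
  next
    case False
    \<comment> \<open>A single player cannot disagree, and the Laplacian has no second eigenvalue.\<close>
    then have "card (UNIV :: 'p set) = 1"
      using zero_less_card_finite[where 'a = 'p] by linarith
    then obtain i0 where i0: "(UNIV :: 'p set) = {i0}"
      by (rule card_1_singletonE)
    have "u $ i0 = 0"
      using u0 unfolding i0 by simp
    then have "u = 0"
      using i0 unfolding vec_eq_iff by (metis UNIV_I singletonD zero_index)
    then show ?thesis
      using rho(2) by (simp add: b_def)
  qed
  \<comment> \<open>Completing the square in the distance of the average to the equilibrium.\<close>
  have "0 \<le> \<eta> * (a - (\<theta>1 + \<theta>2) * b / (2 * \<eta>))\<^sup>2"
    using pos by simp
  also have "\<dots> = \<eta> * a\<^sup>2 - (\<theta>1 + \<theta>2) * a * b + (\<theta>1 + \<theta>2)\<^sup>2 / (4 * \<eta>) * b\<^sup>2"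
    using pos by (simp add: power2_diff power_divide power_mult_distrib field_simps power2_eq_square)
  also have "\<dots> = (\<eta> * a\<^sup>2 - a * (\<theta>2 * b) - b * (\<theta>1 * a) - b * (\<theta>2 * b))
      + ((\<theta>1 + \<theta>2)\<^sup>2 / (4 * \<eta>) + \<theta>2) * b\<^sup>2"
    by (simp add: algebra_simps power2_eq_square)
  also have "\<dots> \<le> (xb - x + R) \<bullet> (FF y - F x) + \<rho> / 2 * (norm (edge_diff E y))\<^sup>2"
    by (rule add_mono[OF low quad])
  finally show ?thesis
    unfolding split .
qed

text \<open>
  A multiplier for the solution of the variational inequality over the feasible set yields an
  inequality over the product of the local sets, which is tested by changing one block at a time.
\<close>

lemma kkt_point_exists:
  fixes G :: "('p::finite, 'c::finite, 'm::finite) game"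
  assumes local: "\<And>i. closed (local_set G i)" "\<And>i. convex (local_set G i)"
    "\<And>i. local_set G i \<subseteq> {v. blk G i v = v}"
    and feasible: "feasible_set G \<noteq> {}" and slater: "slater G"
    and pos: "\<eta> > 0" "\<theta> > 0"
    and mono: "\<And>x x'. (x - x') \<bullet> (F x - F x') \<ge> \<eta> * (norm (x - x'))\<^sup>2"
    and lip: "\<And>x x'. norm (F x - F x') \<le> \<theta> * norm (x - x')"
  obtains x l where "\<And>i. blk G i x \<in> local_set G i"
    "\<And>i w. w \<in> local_set G i \<Longrightarrow> 0 \<le> (blk G i (F x) + transpose (cblk G i) *v l) \<bullet> (w - blk G i x)"
    "l \<in> nonneg_orthant" "\<And>u. u \<in> nonneg_orthant \<Longrightarrow> (cmat G *v x - cvec G) \<bullet> (u - l) \<le> 0"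
proof -
  have closed_joint: "closed (joint_set G)"
    unfolding joint_set_def
    by (intro closed_Collect_all closed_vimage[OF local(1), unfolded vimage_def] continuous_intros)
  have convex_joint: "convex (joint_set G)"
    unfolding joint_set_def convex_def using local(2)
    by (auto simp: linear_add[OF linear_blk] linear_cmul[OF linear_blk] convex_def)
  have "closed (feasible_set G)"
    unfolding feasible_set_def
    by (intro closed_Int closed_joint closed_Collect_all closed_Collect_le continuous_intros
        matrix_vector_mult_linear_continuous_on)
  moreover have "convex (feasible_set G)"
    unfolding feasible_set_def
  proof (intro convex_Int convex_joint)
    have eq: "{x. \<forall>r. (cmat G *v x - cvec G) $ r \<le> 0}
        = (\<Inter>r. {x. row r (cmat G) \<bullet> x \<le> cvec G $ r})"
      by (auto simp: matrix_vector_mul_component row_def vec_lambda_eta)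
    show "convex {x. \<forall>r. (cmat G *v x - cvec G) $ r \<le> 0}"
      unfolding eq by (intro convex_INT convex_halfspace_le)
  qed
  ultimately obtain x where x: "x \<in> feasible_set G"
    and vi: "\<And>w. w \<in> feasible_set G \<Longrightarrow> 0 \<le> F x \<bullet> (w - x)"
    using variational_inequality_solution[OF _ _ feasible pos mono lip] by metis
  obtain x0 where x0: "x0 \<in> joint_set G" "\<And>r. (cmat G *v x0 - cvec G) $ r < 0"
    using slater unfolding slater_def by blast
  have xj: "x \<in> joint_set G" "\<And>r. (cmat G *v x - cvec G) $ r \<le> 0"
    using x unfolding feasible_set_def by auto
  have opt: "0 \<le> F x \<bullet> (w - x)" if "w \<in> joint_set G" "\<And>r. (cmat G *v w - cvec G) $ r \<le> 0" for w
    using that by (intro vi) (simp add: feasible_set_def)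
  obtain l where l: "\<And>r. 0 \<le> l $ r" "l \<bullet> (cmat G *v x - cvec G) = 0"
    "\<And>w. w \<in> joint_set G \<Longrightarrow> 0 \<le> (F x + transpose (cmat G) *v l) \<bullet> (w - x)"
    using lagrange_multiplier[OF convex_joint xj x0 opt] by metis
  show ?thesis
  proof (rule that[of x l])
    show xi: "blk G i x \<in> local_set G i" for i
      using xj(1) by (simp add: joint_set_def)
    show "0 \<le> (blk G i (F x) + transpose (cblk G i) *v l) \<bullet> (w - blk G i x)"
      if w: "w \<in> local_set G i" for i w
    proof -
      have bw: "blk G i w = w"
        using w local(3) by blast
      have "join G i w x \<in> joint_set G"
        unfolding joint_set_def using w xi by (auto simp: blk_join bw)
      from l(3)[OF this] have "0 \<le> (F x + transpose (cmat G) *v l) \<bullet> (w - blk G i x)"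
        by (simp add: join_eq bw)
      also have "(F x + transpose (cmat G) *v l) \<bullet> (w - blk G i x)
          = (F x + transpose (cmat G) *v l) \<bullet> blk G i (w - blk G i x)"
        by (simp add: linear_diff[OF linear_blk] bw)
      also have "\<dots> = (blk G i (F x) + transpose (cblk G i) *v l) \<bullet> (w - blk G i x)"
        by (simp add: inner_blk[symmetric] linear_add[OF linear_blk] transpose_cblk_mult
            del: transpose_matrix_vector)
      finally show ?thesis .
    qed
    show "l \<in> nonneg_orthant"
      using l(1) by (simp add: nonneg_orthant_def)
    show "(cmat G *v x - cvec G) \<bullet> (u - l) \<le> 0" if "u \<in> nonneg_orthant" for u
    proof -
      have "(cmat G *v x - cvec G) \<bullet> u \<le> 0"
        unfolding inner_vec_def using that xj(2)
        by (intro sum_nonpos) (simp add: nonneg_orthant_def mult_nonpos_nonneg)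
      then show ?thesis
        using l(2) by (simp only: inner_diff_right inner_commute[of _ l])
    qed
  qed
qed

text \<open>
  Consensus states see no Laplacian, and the local residuals of the shared constraint sum to the
  global one.  Giving every player an equal share of the global normal vector leaves a balanced remainder,
  which the edge variable \<open>z\<close> routes through the graph; the edge variable \<open>m\<close> can be zero because the
  gradient conditions already hold player by player.
\<close>

lemma consensus_zero_of_kkt_point:
  fixes G :: "('p::finite, 'c::finite, 'm::finite) game" and E :: "('p \<times> 'p) set"
  assumes conn: "weakly_connected E" and b: "(\<Sum>i\<in>UNIV. bvec P i) = cvec G"
    and x: "\<And>i. blk G i x \<in> local_set G i"
    and opt: "\<And>i w. w \<in> local_set G i \<Longrightarrow>
      0 \<le> (blk G i (F x) + transpose (cblk G i) *v l) \<bullet> (w - blk G i x)"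
    and l: "l \<in> nonneg_orthant" "\<And>u. u \<in> nonneg_orthant \<Longrightarrow> (cmat G *v x - cvec G) \<bullet> (u - l) \<le> 0"
  obtains z where "(((\<chi> i. x), (\<chi> i. l), 0, z), - coupling G E P ((\<chi> i. x), (\<chi> i. l), 0, z))
    \<in> game_relation G P F"
proof -
  \<comment> \<open>The share of the global normal vector that is given to each player.\<close>
  let ?n = "(1 / real CARD('p)) *\<^sub>R (cmat G *v x - cvec G)"
  let ?f = "\<chi> i. cblk G i *v x - bvec P i - ?n"
  have "(\<Sum>i\<in>UNIV. ?f $ i) = 0"
    by (simp add: sum_subtractf sum_cblk_mult b sum_constant_scaleR del: sum_constant)
  then obtain z where z: "inflow E z = ?f"
    using inflow_surjective_on_balanced[OF conn] by blast
  have zi: "cblk G i *v x - inflow E z $ i - bvec P i = ?n" for i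
    by (simp add: z)
  show ?thesis
  proof (rule that[of z])
    have "(- (transpose (cblk G i) *v l) - blk G i (F x)) \<bullet> (w - blk G i x) \<le> 0"
      if "w \<in> local_set G i" for i w
      using opt[OF that] by (simp add: inner_add_left inner_diff_left del: transpose_matrix_vector)
    moreover have "blk G i (- (transpose (cblk G i) *v l)) = - (transpose (cblk G i) *v l)" for i
      by (simp add: linear_neg[OF linear_blk] transpose_cblk_mult del: transpose_matrix_vector)
    moreover have "(cblk G i *v x - inflow E z $ i - bvec P i) \<bullet> (u - l) \<le> 0"
      if "u \<in> nonneg_orthant" for i u
      unfolding zi using l(2)[OF that] by (simp add: divide_nonpos_pos)
    ultimately show "(((\<chi> i. x), (\<chi> i. l), 0, z), - coupling G E P ((\<chi> i. x), (\<chi> i. l), 0, z))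
        \<in> game_relation G P F"
      unfolding game_relation_def coupling_def using x l(1)
      by (simp add: linear_0[OF linear_inflow] stacked_constraint_adj_def stacked_constraint_def del: transpose_matrix_vector)
  qed
qed

lemma zero_is_consensus:
  assumes conn: "weakly_connected E"
    and z: "((y, l, m, z), - coupling G E P (y, l, m, z)) \<in> game_relation G P F"
  obtains x u where "y = (\<chi> i. x)" "l = (\<chi> i. u)"
proof -
  have "edge_diff E y = 0" "edge_diff E l = 0"
    using z by (auto simp: game_relation_def coupling_def)
  then show ?thesis
    using edge_diff_eq_0_imp_consensus[OF conn] that by metis
qed

text \<open>
  Summation over the players removes the edge variables.  In the gradient rows the summands have
  disjoint supports, so each of them vanishes; in the constraint rows the normal vectors of the players add up to
  one normal vector, as the normal cone is closed under addition.
\<close>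

lemma consensus_zero_imp_kkt:
  fixes G :: "('p::finite, 'c::finite, 'm::finite) game" and E :: "('p \<times> 'p) set"
  assumes F: "\<And>x. pseudogradient G x = {F x}" and b: "(\<Sum>i\<in>UNIV. bvec P i) = cvec G"
    and z: "(((\<chi> i. x), (\<chi> i. l), m, z), - coupling G E P ((\<chi> i. x), (\<chi> i. l), m, z)) \<in> game_relation G P F"
  shows "vgne_kkt G x l"
proof -
  define p where "p = - (stacked_constraint_adj G (\<chi> i. l) + inflow E m)"
  define q where "q = stacked_constraint G (\<chi> i. x) - inflow E z"
  have p: "\<And>i. blk G i (p $ i) = p $ i" "\<And>i. blk G i x \<in> local_set G i"
    "\<And>i w. w \<in> local_set G i \<Longrightarrow> (p $ i - blk G i (F x)) \<bullet> (w - blk G i x) \<le> 0"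
    and q: "l \<in> nonneg_orthant" "\<And>i u. u \<in> nonneg_orthant \<Longrightarrow> (q $ i - bvec P i) \<bullet> (u - l) \<le> 0"
    using z by (auto simp: game_relation_def coupling_def p_def q_def linear_0[OF linear_inflow])
  \<comment> \<open>The edge multipliers cancel after summation, and each block of the sum has a single summand.\<close>
  have "(\<Sum>i\<in>UNIV. p $ i + stacked_constraint_adj G (\<chi> i. l) $ i) = 0"
    by (simp add: p_def sum_subtractf sum_negf sum_inflow)
  then have "blk G j (\<Sum>i\<in>UNIV. p $ i + stacked_constraint_adj G (\<chi> i. l) $ i) = 0" for j
    by (simp add: linear_0[OF linear_blk])
  moreover have "blk G j (\<Sum>i\<in>UNIV. p $ i + stacked_constraint_adj G (\<chi> i. l) $ i)
      = p $ j + stacked_constraint_adj G (\<chi> i. l) $ j" for j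
  proof -
    have "blk G j (p $ i + stacked_constraint_adj G (\<chi> i. l) $ i)
        = (if i = j then p $ j + stacked_constraint_adj G (\<chi> i. l) $ j else 0)" for i
      using blk_other[of i j G "p $ i"] blk_other[of i j G "stacked_constraint_adj G (\<chi> i. l) $ i"]
      by (auto simp: linear_add[OF linear_blk] p(1) blk_stacked_constraint_adj)
    then show ?thesis
      by (simp add: linear_sum[OF linear_blk])
  qed
  ultimately have pj: "p $ j = - (transpose (cblk G j) *v l)" for j
    by (simp add: stacked_constraint_adj_def eq_neg_iff_add_eq_0 del: transpose_matrix_vector)
  have "0 \<in> {g + transpose (cblk G i) *v l + n | g n.
      g \<in> partial_subdiff G i x \<and> n \<in> normal_cone (local_set G i) (blk G i x)}" for i
  proof -
    have "p $ i - blk G i (F x) \<in> normal_cone (local_set G i) (blk G i x)"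
      using p(2,3) by (simp add: normal_cone_def)
    moreover have "blk G i (F x) \<in> partial_subdiff G i x"
      by (simp add: partial_subdiff_eq_gradient[OF F])
    moreover have "0 = blk G i (F x) + transpose (cblk G i) *v l + (p $ i - blk G i (F x))"
      by (simp add: pj del: transpose_matrix_vector)
    ultimately show ?thesis
      by blast
  qed
  moreover have "0 \<in> {- (cmat G *v x - cvec G) + n | n. n \<in> normal_cone nonneg_orthant l}"
  proof -
    have sum: "(\<Sum>i\<in>UNIV. q $ i - bvec P i) = cmat G *v x - cvec G"
      by (simp add: q_def sum_subtractf sum_inflow stacked_constraint_def sum_cblk_mult b)
    have "(cmat G *v x - cvec G) \<bullet> (u - l) \<le> 0" if "u \<in> nonneg_orthant" for u
      unfolding sum[symmetric] inner_sum_left by (intro sum_nonpos q(2)[OF that])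
    then have "cmat G *v x - cvec G \<in> normal_cone nonneg_orthant l"
      using q(1) by (simp add: normal_cone_def)
    then show ?thesis
      by force
  qed
  ultimately show ?thesis
    unfolding vgne_kkt_def by blast
qed

section \<open>Convergence to a variational equilibrium\<close>

theorem theorem3:
  fixes G :: "('p::finite, 'c::finite, 'm::finite) game"
    and E :: "('p \<times> 'p) set"
    and P :: "('p, 'm) params"
    and init :: "('p, 'c, 'm) iterate"
    and F :: "real^'c \<Rightarrow> real^'c"
    and FF :: "(real^'c)^'p \<Rightarrow> real^'c"
    and \<eta> \<theta>1 \<theta>2 :: real
  assumes local_sub: "\<And>i. local_set G i \<subseteq> {v. blk G i v = v}"
    and cost_proper: "\<And>i x. proper_fun (\<lambda>v. cost G i (join G i v x))"
    and cost_lsc: "\<And>i x. lsc_fun (\<lambda>v. cost G i (join G i v x))"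
    and cost_convex: "\<And>i x. convex_fun (\<lambda>v. cost G i (join G i v x))"
    and local_ne: "\<And>i. local_set G i \<noteq> {}"
    and local_closed: "\<And>i. closed (local_set G i)"
    and local_convex: "\<And>i. convex (local_set G i)"
    and feasible_ne: "feasible_set G \<noteq> {}"
    and slater: "slater G"
    and connected: "weakly_connected E"
    and no_loops: "irrefl E"
    and F_single: "\<And>x. pseudogradient G x = {F x}"
    and FF_single: "\<And>Y. ext_pseudogradient G Y = {FF Y}"
    and constants_pos: "\<eta> > 0" "\<theta>1 > 0" "\<theta>2 > 0"
    and F_strongly_monotone: "\<And>x x'. (x - x') \<bullet> (F x - F x') \<ge> \<eta> * (norm (x - x'))\<^sup>2"
    and F_lipschitz: "\<And>x x'. norm (F x - F x') \<le> \<theta>1 * norm (x - x')"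
    and FF_lipschitz: "\<And>Y Y'. norm (FF Y - FF Y') \<le> \<theta>2 * norm (Y - Y')"
    and rho_nonneg: "rho_mu P \<ge> 0" "rho_z P \<ge> 0"
    and b_split: "(\<Sum>i\<in>UNIV. bvec P i) = cvec G"
    and tau_pos: "\<And>i. tau1 P i > 0" "\<And>i. tau2 P i > 0"
      "\<And>e. e \<in> E \<Longrightarrow> tau3 P e > 0" "\<And>e. e \<in> E \<Longrightarrow> tau4 P e > 0"
    and tau1_bound: "\<And>i. inverse (tau1 P i) >
      1/2 * mat_norm1 (cblk G i) + (1/2 + rho_mu P) * real (degree_of E i)"
    and tau2_bound: "\<And>i. inverse (tau2 P i) >
      1/2 * mat_norm_inf (cblk G i) + (1/2 + rho_z P) * real (degree_of E i)"
    and tau3_bound: "\<And>e. e \<in> E \<Longrightarrow> inverse (tau3 P e) > 1"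
    and tau4_bound: "\<And>e. e \<in> E \<Longrightarrow> inverse (tau4 P e) > 1"
    and rho_mu_bound: "rho_mu P \<ge> 2 / second_smallest_eigenvalue (laplacian E)
      * ((\<theta>1 + \<theta>2)\<^sup>2 / (4 * \<eta>) + \<theta>2)"
  shows "\<exists>ystar lstar.
      (\<lambda>k. yv (main_seq G E P init k)) \<longlonglongrightarrow> (\<chi> i. ystar) \<and>
      (\<lambda>k. lv (main_seq G E P init k)) \<longlonglongrightarrow> (\<chi> i. lstar) \<and>
      is_vgne G ystar \<and> vgne_kkt G ystar lstar"
proof -
  let ?B = "\<lambda>x. (1/2) *\<^sub>R coupling G E P x"
  let ?A = "{(x, a). (x, a - ?B x) \<in> game_relation G P F}"
  let ?t = "\<lambda>k. encode E (tilde_seq G E P init k)"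
  let ?w = "\<lambda>k. encode E (main_seq G E P init k)"
  have contF: "continuous_on UNIV F"
    using F_lipschitz constants_pos(2)
    by (intro lipschitz_on_continuous_on[of \<theta>1] lipschitz_onI) (auto simp: dist_norm)
  have linB: "linear ?B"
    by (intro linear_compose_scale_right linear_coupling)
  have B_form: "x \<bullet> ?B x = 1/2 * (rho_mu P * (norm (edge_diff E (fst x)))\<^sup>2)
      + 1/2 * (rho_z P * (norm (edge_diff E (fst (snd x))))\<^sup>2)" for x
    using inner_coupling[of "fst x" "fst (snd x)" "fst (snd (snd x))" "snd (snd (snd x))" G E P] by simp
  have monoB: "0 \<le> x \<bullet> ?B x" for x
    unfolding B_form using rho_nonneg by simp
  have closedA: "closed ?A"
  proof -
    have eq: "?A = (\<lambda>p. (fst p, snd p - ?B (fst p))) -` game_relation G P F"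
      by auto
    have "continuous_on UNIV (\<lambda>p. (fst p, snd p - ?B (fst p)))"
      by (intro continuous_intros bounded_linear.continuous_on[OF linear_coupling[unfolded linear_conv_bounded_linear]])
    then show ?thesis
      unfolding eq by (intro closed_vimage closed_game_relation local_closed contF)
  qed
  have zero_iff: "(z, - ?B z) \<in> ?A \<longleftrightarrow> (z, - coupling G E P z) \<in> game_relation G P F" for z
  proof -
    have "- ?B z - ?B z = - coupling G E P z"
      unfolding minus_add_distrib[symmetric] diff_conv_add_uminus
      by (simp add: scaleR_left_distrib[symmetric])
    then show ?thesis
      by simp
  qed
  have monoA: "0 \<le> (x - z) \<bullet> (a + ?B z)" if xA: "(x, a) \<in> ?A" and zA: "(z, - ?B z) \<in> ?A" for x a z
  proof -
    obtain y l m e where x: "x = (y, l, m, e)"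
      by (cases x rule: prod_cases4)
    obtain y' l' m' e' where z: "z = (y', l', m', e')"
      by (cases z rule: prod_cases4)
    obtain p q r s where p: "a - ?B x = (p, q, r, s)"
      by (cases "a - ?B x" rule: prod_cases4)
    obtain p' q' r' s' where p': "- coupling G E P z = (p', q', r', s')"
      by (cases "- coupling G E P z" rule: prod_cases4)
    have xp: "((y, l, m, e), (p, q, r, s)) \<in> game_relation G P F"
      using xA unfolding p[symmetric] x[symmetric] by simp
    have zp: "((y', l', m', e'), (p', q', r', s')) \<in> game_relation G P F"
      using zA unfolding zero_iff p'[symmetric] z[symmetric] .
    obtain xs where y': "y' = (\<chi> i. xs)"
      using zero_is_consensus[OF connected zA[unfolded zero_iff z]] by metis
    have sum: "(p, q, r, s) - (p', q', r', s') + ?B (x - z) = a + ?B z"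
    proof -
      have "?B (x - z) = ?B x - ?B z"
        by (simp add: linear_diff[OF linear_coupling] scaleR_diff_right)
      moreover have "coupling G E P z - ?B z = ?B z"
        using scaleR_left_diff_distrib[of 1 "1/2" "coupling G E P z"] by simp
      ultimately show ?thesis
        unfolding p[symmetric] p'[symmetric] by simp
    qed
    have "(x - z) \<bullet> (a + ?B z)
        = (x - z) \<bullet> ((p, q, r, s) - (p', q', r', s')) + (x - z) \<bullet> ?B (x - z)"
      unfolding sum[symmetric] by (rule inner_add_right)
    \<comment> \<open>The skew part of the coupling has dropped out, and \<open>y'\<close> is a consensus state.\<close>
    also have "\<dots> = (y - y') \<bullet> (p - p') + rho_mu P / 2 * (norm (edge_diff E y))\<^sup>2
        + (l - l') \<bullet> (q - q') + rho_z P / 2 * (norm (edge_diff E (l - l')))\<^sup>2"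
      using xp zp unfolding B_form
      by (simp add: x z game_relation_def y' linear_diff[OF linear_edge_diff])
    also have "\<dots> \<ge> 0"
    proof -
      have blocks: "blk G i (y $ i - xs) \<bullet> (blk G i (F (y $ i)) - blk G i (F xs))
          \<le> (y $ i - xs) \<bullet> (p $ i - p' $ i)" for i
      proof -
        let ?d = "blk G i (y $ i) - blk G i xs"
        have "blk G i (p $ i - p' $ i) = p $ i - p' $ i"
          using xp zp by (simp add: game_relation_def linear_diff[OF linear_blk])
        then have "(y $ i - xs) \<bullet> (p $ i - p' $ i) = ?d \<bullet> (p $ i - p' $ i)"
          using inner_blk[of G i "y $ i - xs" "p $ i - p' $ i"] by (simp add: linear_diff[OF linear_blk])
        moreover have "blk G i (y $ i) \<in> local_set G i" "blk G i xs \<in> local_set G i"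
          using xp zp by (auto simp: game_relation_def y')
        then have "(p $ i - blk G i (F (y $ i))) \<bullet> (blk G i xs - blk G i (y $ i)) \<le> 0"
          "(p' $ i - blk G i (F xs)) \<bullet> (blk G i (y $ i) - blk G i xs) \<le> 0"
          using xp zp by (auto simp: game_relation_def y')
        ultimately show ?thesis
          by (simp add: linear_diff[OF linear_blk] inner_simps inner_commute)
      qed
      have multipliers: "0 \<le> (l $ i - l' $ i) \<bullet> (q $ i - q' $ i)" for i
      proof -
        have "(q $ i - bvec P i) \<bullet> (l' $ i - l $ i) \<le> 0" "(q' $ i - bvec P i) \<bullet> (l $ i - l' $ i) \<le> 0"
          using xp zp by (auto simp: game_relation_def)
        then show ?thesis
          by (simp add: inner_simps inner_commute)
      qed
      have "0 \<le> (\<Sum>i\<in>UNIV. blk G i (y $ i - xs) \<bullet> (blk G i (F (y $ i)) - blk G i (F xs)))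
          + rho_mu P / 2 * (norm (edge_diff E y))\<^sup>2"
        by (rule extended_pseudogradient_restricted_monotone[OF F_single FF_single constants_pos
            F_strongly_monotone F_lipschitz FF_lipschitz no_loops connected rho_mu_bound rho_nonneg(1)])
      also have "\<dots> \<le> (y - y') \<bullet> (p - p') + rho_mu P / 2 * (norm (edge_diff E y))\<^sup>2"
        unfolding inner_vec_def[of "y - y'"] using blocks by (simp add: y' sum_mono)
      finally have "0 \<le> (y - y') \<bullet> (p - p') + rho_mu P / 2 * (norm (edge_diff E y))\<^sup>2" .
      moreover have "0 \<le> (l - l') \<bullet> (q - q')"
        unfolding inner_vec_def[of "l - l'"] using multipliers by (simp add: sum_nonneg)
      moreover have "0 \<le> rho_z P / 2 * (norm (edge_diff E (l - l')))\<^sup>2"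
        using rho_nonneg by simp
      ultimately show ?thesis
        by linarith
    qed
    finally show ?thesis
      by simp
  qed
  obtain xs ls where kkt: "\<And>i. blk G i xs \<in> local_set G i"
    "\<And>i w. w \<in> local_set G i \<Longrightarrow> 0 \<le> (blk G i (F xs) + transpose (cblk G i) *v ls) \<bullet> (w - blk G i xs)"
    "ls \<in> nonneg_orthant" "\<And>u. u \<in> nonneg_orthant \<Longrightarrow> (cmat G *v xs - cvec G) \<bullet> (u - ls) \<le> 0"
    using kkt_point_exists[OF local_closed local_convex local_sub feasible_ne slater constants_pos(1,2)
        F_strongly_monotone F_lipschitz] by blast
  obtain z0 where zero: "(z0, - ?B z0) \<in> ?A"
    unfolding zero_iff
    using consensus_zero_of_kkt_point[where F = F and x = xs and l = ls, OF connected b_split kkt] by blast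
  have stepA: "(?w k, precond G E P (?t k - ?w k)) \<in> ?A" for k
    using main_step_inclusion[OF F_single contF local_sub local_closed local_convex local_ne tau_pos]
    by (simp add: main_seq_def)
  have stepB: "precond G E P (?w k - ?t (Suc k)) = ?B (?w k + ?t (Suc k) - ?t k)" for k
    using tilde_step_equation[OF tau_pos] by (simp add: main_seq_def tilde_seq_def)
  have posM: "0 < x \<bullet> precond G E P x" if "x \<noteq> 0" for x
    by (rule precond_positive_definite[OF no_loops rho_nonneg tau1_bound tau2_bound tau3_bound tau4_bound that])
  obtain z where z: "(z, - ?B z) \<in> ?A" and lim: "?w \<longlonglongrightarrow> z"
    by (rule preconditioned_douglas_rachford_converges[where Q = "precond G E P" and B = ?B and A = ?A
          and w = ?w and t = ?t, OF linear_precond precond_symmetric posM linB monoB closedA monoA zero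
          stepA stepB])
  obtain y l m e where ze: "z = (y, l, m, e)"
    by (cases z rule: prod_cases4)
  have z': "((y, l, m, e), - coupling G E P (y, l, m, e)) \<in> game_relation G P F"
    using z unfolding zero_iff ze .
  obtain ystar lstar where star: "y = (\<chi> i. ystar)" "l = (\<chi> i. lstar)"
    using zero_is_consensus[OF connected z'] by blast
  have kkt: "vgne_kkt G ystar lstar"
    using consensus_zero_imp_kkt[OF F_single b_split] z' unfolding star by blast
  have "(\<lambda>k. yv (main_seq G E P init k)) \<longlonglongrightarrow> (\<chi> i. ystar)"
    using tendsto_fst[OF lim] by (simp add: encode_def ze star)
  moreover have "(\<lambda>k. lv (main_seq G E P init k)) \<longlonglongrightarrow> (\<chi> i. lstar)"
    using tendsto_fst[OF tendsto_snd[OF lim]] by (simp add: encode_def ze star)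
  ultimately show ?thesis
    using kkt unfolding is_vgne_def by blast
qed

end
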